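(* Let $n$ be even and split the sample into $(X_I,Y_I)$ (rows $1,\dots,n/2$) and $(X_{II},Y_{II})$ (rows $n/2+1,\dots,n$). Let $\hat\beta_I$ be an estimator of $\beta^0$ based only on $(X_I,Y_I)$ and $\hat\beta_{II}$ an estimator based only on $(X_{II},Y_{II})$. Let $(\gamma^\sharp,\lambda^\sharp)$ be an eligible pair, let (for $n$ large) $$\Theta_1^\sharp:=\begin{pmatrix}1\\-\gamma^\sharp\end{pmatrix}\Big/\big(1-\gamma^{0T}\Sigma_{-1,-1}\gamma^\sharp\big),$$ with first entry $\Theta^\sharp_{1,1}$, and define $$\hat b^\sharp_{I,1}:=\hat\beta_{II,1}+2\Theta_1^{\sharp T}X_I^T(Y_I-X_I\hat\beta_{II})/n,\qquad \hat b^\sharp_{II,1}:=\hat\beta_{I,1}+2\Theta_1^{\sharp T}X_{II}^T(Y_{II}-X_{II}\hat\beta_{I})/n,$$ and $\hat b^\sharp_1:=(\hat b^\sharp_{I,1}+\hat b^\sharp_{II,1})/2$. Suppose that, uniformly in $\beta^0\in\mathcal{B}$, $$\|\Sigma^{1/2}(\hat\beta_I-\beta^0)\|_2=o_{\mathbb{P}_{\beta^0}}(1),\quad \|\Sigma^{1/2}(\hat\beta_{II}-\beta^0)\|_2=o_{\mathbb{P}_{\beta^0}}(1),$$ and $$\sqrt n\lambda^\sharp\|\hat\beta_I-\beta^0\|_1=o_{\mathbb{P}_{\beta^0}}(1),\quad \sqrt n\lambda^\sharp\|\hat\beta_{II}-\beta^0\|_1=o_{\mathbb{P}_{\beta^0}}(1).$$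 Then, uniformly in $\beta^0\in\mathcal{B}$, $$\hat b^\sharp_1-\beta^0_1=\Theta_1^{\sharp T}X^T\epsilon/n+o_{\mathbb{P}_{\beta^0}}(1/\sqrt n),$$ and $$\lim_{n\to\infty}\sup_{\beta^0\in\mathcal{B}}\mathbb{P}_{\beta^0}\Big(\frac{\sqrt n(\hat b^\sharp_1-\beta^0_1)}{\sqrt{\Theta^\sharp_{1,1}}}\le z\Big)=\Phi(z)\quad\text{for all }z\in\mathbb{R}.$$
   Context: Asymptotic framework: all quantities may depend on $n$; limits are as $n\to\infty$. The rows of $(X,Y)\in\mathbb{R}^{n\times(p+1)}$ are i.i.d. copies of a zero-mean Gaussian row vector $(\mathbf{x},\mathbf{y})$, $\mathbf{x}=(\mathbf{x}_1,\dots,\mathbf{x}_p)$, with $\Sigma:=\mathbb{E}\mathbf{x}^T\mathbf{x}$ known, nonsingular, all diagonal entries $1$, smallest eigenvalue $\Lambda^2_{\min}$ with $1/\Lambda^2_{\min}=\mathcal{O}(1)$. $\beta^0=\Sigma^{-1}\mathbb{E}\mathbf{x}^T\mathbf{y}$ lies in a given model class $\mathcal{B}\subseteq\mathbb{R}^p$, $\epsilon:=Y-X\beta^0$, and $\mathbb{E}(\mathbf{y}-\mathbf{x}\beta^0)^2=1$. $\Phi$ is the standard normal cdf. $\mathbf{x}_{-1}=(\mathbf{x}_2,\dots,\mathbf{x}_p)$, $\Sigma_{-1,-1}=\mathbb{E}\mathbf{x}_{-1}^T\mathbf{x}_{-1}$, $\gamma^0:=\Sigma_{-1,-1}^{-1}\mathbb{E}\mathbf{x}_{-1}^T\mathbf{x}_1$.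 A pair $(\gamma^\sharp,\lambda^\sharp)$, $\gamma^\sharp\in\mathbb{R}^{p-1}$, $\lambda^\sharp>0$, is eligible if $\|\Sigma_{-1,-1}(\gamma^\sharp-\gamma^0)\|_\infty\le\lambda^\sharp$ and $\lambda^\sharp\|\gamma^\sharp\|_1\to0$. A sequence of random variables $Z_n$ is $o_{\mathbb{P}_{\beta^0}}(r_n)$ uniformly in $\beta^0\in\mathcal{B}$ if $\lim_n\sup_{\beta^0\in\mathcal{B}}\mathbb{P}_{\beta^0}(|Z_n|>\eta r_n)=0$ for all $\eta>0$. *)

theory Defs
  imports "HOL-Probability.Probability" "HOL-Library.Landau_Symbols"
begin

text \<open>Conventions. Sizes depend on the sample size n. Vectors in R^p are functions
  nat => real on the index set 0..<p (paper coordinate k is index k-1), matrices are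
  functions nat => nat => real. Coordinate 1 of the paper is index 0.\<close>

definition evens :: "nat filter" where
  "evens = filtermap (\<lambda>m. 2 * m) sequentially"

definition Phi :: "real \<Rightarrow> real" where
  "Phi = cdf std_normal_distribution"

text \<open>Probability space carrying the sample: n x (p+1) i.i.d. standard normals
  omega(i,k). Columns k<p generate the design, column p the noise.\<close>
definition sample_space :: "nat \<Rightarrow> nat \<Rightarrow> ((nat \<times> nat) \<Rightarrow> real) measure" where
  "sample_space n p = PiM ({0..<n} \<times> {0..<Suc p}) (\<lambda>_. std_normal_distribution)"

text \<open>Design X = Z R with R^T R = Sigma, so the rows of X are i.i.d. N(0, Sigma).\<close>
definition design :: "nat \<Rightarrow> (nat \<Rightarrow> nat \<Rightarrow> real) \<Rightarrow> ((nat \<times> nat) \<Rightarrow> real) \<Rightarrow> nat \<Rightarrow> nat \<Rightarrow> real" where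
  "design p R \<omega> i j = (\<Sum>k<p. \<omega> (i, k) * R k j)"

definition noise :: "nat \<Rightarrow> ((nat \<times> nat) \<Rightarrow> real) \<Rightarrow> nat \<Rightarrow> real" where
  "noise p \<omega> i = \<omega> (i, p)"

definition response :: "nat \<Rightarrow> (nat \<Rightarrow> nat \<Rightarrow> real) \<Rightarrow> (nat \<Rightarrow> real) \<Rightarrow> ((nat \<times> nat) \<Rightarrow> real) \<Rightarrow> nat \<Rightarrow> real" where
  "response p R b \<omega> i = (\<Sum>j<p. design p R \<omega> i j * b j) + noise p \<omega> i"

definition unif_oP :: "'f filter \<Rightarrow> ('f \<Rightarrow> 'b set) \<Rightarrow> ('f \<Rightarrow> 'a measure)
    \<Rightarrow> ('f \<Rightarrow> 'b \<Rightarrow> 'a \<Rightarrow> real) \<Rightarrow> ('f \<Rightarrow> real) \<Rightarrow> bool" where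
  "unif_oP F B M Z r \<longleftrightarrow>
     (\<forall>\<eta>>0. ((\<lambda>n. SUP b\<in>B n. measure (M n) {\<omega>\<in>space (M n). \<bar>Z n b \<omega>\<bar> > \<eta> * r n}) \<longlongrightarrow> 0) F)"

text \<open>Real eigenvalues of a p x p matrix, and the smallest one
  (for a symmetric matrix these are all eigenvalues).\<close>
definition is_eigenvalue :: "nat \<Rightarrow> (nat \<Rightarrow> nat \<Rightarrow> real) \<Rightarrow> real \<Rightarrow> bool" where
  "is_eigenvalue p A l \<longleftrightarrow>
     (\<exists>v. (\<exists>i<p. v i \<noteq> 0) \<and> (\<forall>i<p. (\<Sum>j<p. A i j * v j) = l * v i))"

definition min_eigenvalue :: "nat \<Rightarrow> (nat \<Rightarrow> nat \<Rightarrow> real) \<Rightarrow> real" where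
  "min_eigenvalue p A = Min {l. is_eigenvalue p A l}"

definition nonsingular :: "nat \<Rightarrow> (nat \<Rightarrow> nat \<Rightarrow> real) \<Rightarrow> bool" where
  "nonsingular p A \<longleftrightarrow> (\<forall>v. (\<forall>i<p. (\<Sum>j<p. A i j * v j) = 0) \<longrightarrow> (\<forall>i<p. v i = 0))"

text \<open>gamma0 = Sigma_{-1,-1}^{-1} E x_{-1}^T x_1, indexed by 1..<p: the unique solution
  of Sigma_{-1,-1} g = Sigma_{-1,1}.\<close>
definition gamma0 :: "nat \<Rightarrow> (nat \<Rightarrow> nat \<Rightarrow> real) \<Rightarrow> nat \<Rightarrow> real" where
  "gamma0 p S = (THE g. (\<forall>i\<in>{1..<p}. (\<Sum>j\<in>{1..<p}. S i j * g j) = S i 0)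
                        \<and> (\<forall>j. j \<notin> {1..<p} \<longrightarrow> g j = 0))"

definition Theta1 :: "nat \<Rightarrow> (nat \<Rightarrow> nat \<Rightarrow> real) \<Rightarrow> (nat \<Rightarrow> real) \<Rightarrow> nat \<Rightarrow> real" where
  "Theta1 p S g j =
     (if j = 0 then 1 else if j < p then - g j else 0)
       / (1 - (\<Sum>i\<in>{1..<p}. \<Sum>k\<in>{1..<p}. gamma0 p S i * S i k * g k))"

definition onestep :: "nat \<Rightarrow> nat \<Rightarrow> (nat \<Rightarrow> real) \<Rightarrow> (nat \<Rightarrow> nat \<Rightarrow> real) \<Rightarrow> (nat \<Rightarrow> real)
    \<Rightarrow> nat set \<Rightarrow> (nat \<Rightarrow> real) \<Rightarrow> real" where
  "onestep n p \<Theta> X Y Rs b =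
     b 0 + 2 * (\<Sum>j<p. \<Theta> j * (\<Sum>i\<in>Rs. X i j * (Y i - (\<Sum>k<p. X i k * b k)))) / real n"

text \<open>Quadratic form v^T A v; ||Sigma^{1/2} v||_2 = sqrt (v^T Sigma v).\<close>
definition qform :: "nat \<Rightarrow> (nat \<Rightarrow> nat \<Rightarrow> real) \<Rightarrow> (nat \<Rightarrow> real) \<Rightarrow> real" where
  "qform p A v = (\<Sum>i<p. \<Sum>j<p. v i * A i j * v j)"

definition bhat :: "nat \<Rightarrow> nat \<Rightarrow> (nat \<Rightarrow> nat \<Rightarrow> real) \<Rightarrow> (nat \<Rightarrow> real)
    \<Rightarrow> ((nat \<Rightarrow> nat \<Rightarrow> real) \<Rightarrow> (nat \<Rightarrow> real) \<Rightarrow> nat \<Rightarrow> real)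
    \<Rightarrow> ((nat \<Rightarrow> nat \<Rightarrow> real) \<Rightarrow> (nat \<Rightarrow> real) \<Rightarrow> nat \<Rightarrow> real)
    \<Rightarrow> (nat \<Rightarrow> real) \<Rightarrow> ((nat \<times> nat) \<Rightarrow> real) \<Rightarrow> real" where
  "bhat n p R \<Theta> estI estII b \<omega> =
     (let X = design p R \<omega>; Y = response p R b \<omega> in
       (onestep n p \<Theta> X Y {0..<n div 2} (estII X Y)
        + onestep n p \<Theta> X Y {n div 2..<n} (estI X Y)) / 2)"

end

theory Submission
  imports Defs "Jordan_Normal_Form.Char_Poly"
begin

text \<open>
  Write \<open>\<delta>\<close> for the error of the estimator built from the other half of the sample, \<open>n = 2m\<close>.
  On each half, the error of the one-step estimator is
  \<open>\<Theta>\<^sup>T X\<^sup>T \<epsilon> / m + (e\<^sub>1 - \<Sigma>\<Theta>)\<^sup>T \<delta> + \<Theta>\<^sup>T (\<Sigma> - X\<^sup>T X / m) \<delta>\<close>.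
  Eligibility bounds the entries of \<open>e\<^sub>1 - \<Sigma>\<Theta>\<close> by a multiple of \<open>\<lambda>\<close>, which settles the second
  term by the condition on the \<open>\<ell>\<^sub>1\<close>-error. Conditionally on the other half, the third term is a centred
  mean of \<open>m\<close> independent products of Gaussians, with variance at most
  \<open>3 (\<Theta>\<^sup>T \<Sigma> \<Theta>) (\<delta>\<^sup>T \<Sigma> \<delta>) / m\<close>, and Chebyshev's inequality applies.
  The leading term is, up to the factor \<open>\<surd>(\<Theta>\<^sup>T \<Sigma> \<Theta>)\<close>, a mean of independent products of two
  independent standard normals, so that the central limit theorem and
  \<open>\<Theta>\<^sup>T \<Sigma> \<Theta> / \<Theta>\<^sub>1\<^sub>1 \<longlonglongrightarrow> 1\<close> give the limit law.
  All bounds on \<open>\<Theta>\<close> come from \<open>1 / \<Theta>\<^sub>1\<^sub>1 = v\<^sup>T \<Sigma> v + o(1)\<close> with \<open>v = (1, -\<gamma>)\<close>, which is at least the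
  smallest eigenvalue up to \<open>o(1)\<close>, and from \<open>\<Theta>\<^sup>T \<Sigma> \<Theta> \<ge> 1\<close>.
\<close>

subsection \<open>Quadratic forms and the smallest eigenvalue\<close>

definition mv :: "nat \<Rightarrow> (nat \<Rightarrow> nat \<Rightarrow> real) \<Rightarrow> (nat \<Rightarrow> real) \<Rightarrow> nat \<Rightarrow> real" where
  "mv p A v i = (\<Sum>j<p. A i j * v j)"

definition dotp :: "nat \<Rightarrow> (nat \<Rightarrow> real) \<Rightarrow> (nat \<Rightarrow> real) \<Rightarrow> real" where
  "dotp p u v = (\<Sum>i<p. u i * v i)"

lemma dotp_commute: "dotp p u v = dotp p v u"
  by (simp add: dotp_def mult.commute)

lemma dotp_self_nonneg: "0 \<le> dotp p v v"
  by (simp add: dotp_def sum_nonneg)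

lemma dotp_self_eq_0: "dotp p v v = 0 \<longleftrightarrow> (\<forall>i<p. v i = 0)"
  by (auto simp: dotp_def sum_nonneg_eq_0_iff)

lemma component_le_dotp_self: "i < p \<Longrightarrow> v i * v i \<le> dotp p v v"
  unfolding dotp_def by (rule member_le_sum) auto

lemma dotp_diff_scaleR_left: "dotp p (\<lambda>i. u i - s * v i) w = dotp p u w - s * dotp p v w"
  by (simp add: dotp_def algebra_simps sum_subtractf sum_distrib_left)

lemma dotp_diff_scaleR_right: "dotp p w (\<lambda>i. u i - s * v i) = dotp p w u - s * dotp p w v"
  using dotp_diff_scaleR_left dotp_commute by metis

lemma qform_eq_dotp: "qform p A v = dotp p v (mv p A v)"
  by (simp add: qform_def dotp_def mv_def sum_distrib_left mult.assoc)

lemma mv_diff_scaleR: "mv p A (\<lambda>i. u i - s * v i) = (\<lambda>i. mv p A u i - s * mv p A v i)"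
  by (rule ext) (simp add: mv_def algebra_simps sum_subtractf sum_distrib_left)

lemma dotp_mv_sym:
  assumes "\<And>i j. i < p \<Longrightarrow> j < p \<Longrightarrow> A i j = A j i"
  shows "dotp p u (mv p A v) = dotp p (mv p A u) v"
proof -
  have "dotp p u (mv p A v) = (\<Sum>i<p. \<Sum>j<p. u i * A i j * v j)"
    by (simp add: dotp_def mv_def sum_distrib_left mult.assoc)
  also have "\<dots> = (\<Sum>j<p. \<Sum>i<p. u i * A i j * v j)"
    by (rule sum.swap)
  also have "\<dots> = dotp p (mv p A u) v"
    unfolding dotp_def mv_def sum_distrib_right
    by (intro sum.cong) (auto simp: assms mult.commute)
  finally show ?thesis .
qed

text \<open>\<open>nonsingular\<close> says that the kernel is trivial. In the matrix type this
  becomes a nonzero determinant, hence an inverse; only A C v = v is kept, which solves A w = v in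
  the function encoding.\<close>

lemma nonsingular_inverse:
  assumes "nonsingular p A"
  obtains C where "\<And>v i. i < p \<Longrightarrow> mv p A (mv p C v) i = v i"
proof -
  let ?M = "mat p p (\<lambda>(i, j). A i j)"
  have M: "?M \<in> carrier_mat p p" by simp
  have "det ?M \<noteq> 0"
  proof
    assume "det ?M = 0"
    then obtain v where v: "v \<in> carrier_vec p" "v \<noteq> 0\<^sub>v p" "?M *\<^sub>v v = 0\<^sub>v p"
      using det_0_iff_vec_prod_zero_field[OF M] by blast
    have "(\<Sum>j<p. A i j * v $ j) = 0" if "i < p" for i
    proof -
      have "(?M *\<^sub>v v) $ i = (\<Sum>j<p. A i j * v $ j)"
        using that v(1) by (simp add: scalar_prod_def lessThan_atLeast0)
      then show ?thesis using that v(3) by simp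
    qed
    then have "\<forall>i<p. v $ i = 0" using assms unfolding nonsingular_def by blast
    with v(1) have "v = 0\<^sub>v p" by (intro eq_vecI) auto
    with v(2) show False by simp
  qed
  \<comment> \<open>The value \<open>()\<close> fills the extension slot of the record
    \<open>ring_mat\<close>, whose units are the invertible matrices.\<close>
  from det_non_zero_imp_unit[OF M this, of "()"]
  obtain C where C: "C \<in> carrier_mat p p" "?M * C = 1\<^sub>m p"
    unfolding Units_def ring_mat_def by auto
  have CC: "(\<Sum>j<p. A i j * C $$ (j, k)) = (if i = k then 1 else 0)" if "i < p" "k < p" for i k
  proof -
    have "(?M * C) $$ (i, k) = (\<Sum>j<p. A i j * C $$ (j, k))"
      using that C(1) by (simp add: scalar_prod_def lessThan_atLeast0)
    then show ?thesis using that C(2) by simp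
  qed
  have "mv p A (mv p (\<lambda>i j. C $$ (i, j)) v) i = v i" if "i < p" for v i
  proof -
    have "mv p A (mv p (\<lambda>i j. C $$ (i, j)) v) i = (\<Sum>j<p. \<Sum>k<p. A i j * C $$ (j, k) * v k)"
      by (simp add: mv_def sum_distrib_left mult.assoc)
    also have "\<dots> = (\<Sum>k<p. \<Sum>j<p. A i j * C $$ (j, k) * v k)"
      by (rule sum.swap)
    also have "\<dots> = (\<Sum>k<p. if i = k then v k else 0)"
      using CC[OF that] by (intro sum.cong) (auto simp: sum_distrib_right[symmetric])
    also have "\<dots> = v i" using that by simp
    finally show ?thesis .
  qed
  then show ?thesis by (rule that)
qed

text \<open>Every eigenvalue is a root of the characteristic polynomial, which is monic and thus
  nonzero. Finiteness is what gives \<open>Min\<close> in \<open>min_eigenvalue\<close> its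
  meaning.\<close>

lemma finite_eigenvalues: "finite {l. is_eigenvalue p A l}"
proof -
  let ?M = "mat p p (\<lambda>(i, j). A i j)"
  have M: "?M \<in> carrier_mat p p" by simp
  have "{l. is_eigenvalue p A l} \<subseteq> {l. poly (char_poly ?M) l = 0}"
  proof
    fix l assume "l \<in> {l. is_eigenvalue p A l}"
    then obtain v where v: "\<exists>i<p. v i \<noteq> 0" "\<forall>i<p. (\<Sum>j<p. A i j * v j) = l * v i"
      unfolding is_eigenvalue_def by blast
    from v(1) obtain i where i: "i < p" "v i \<noteq> 0" by blast
    have "Matrix.vec p v \<noteq> 0\<^sub>v p"
    proof
      assume "Matrix.vec p v = 0\<^sub>v p"
      then have "Matrix.vec p v $ i = 0\<^sub>v p $ i" by simp
      with i show False by simp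
    qed
    moreover have "?M *\<^sub>v Matrix.vec p v = l \<cdot>\<^sub>v Matrix.vec p v"
      using v(2) by (intro eq_vecI) (auto simp: scalar_prod_def lessThan_atLeast0)
    ultimately have "eigenvector ?M (Matrix.vec p v) l"
      unfolding eigenvector_def by simp
    then show "l \<in> {l. poly (char_poly ?M) l = 0}"
      using eigenvalue_root_char_poly[OF M] unfolding eigenvalue_def by auto
  qed
  moreover have "char_poly ?M \<noteq> 0"
    using degree_monic_char_poly[OF M] by auto
  ultimately show ?thesis
    using poly_roots_finite finite_subset by blast
qed

text \<open>Testing semidefiniteness at \<open>v - s A\<^sup>-\<^sup>1 v\<close> bounds the form from below
  in terms of the norm of \<open>A\<^sup>-\<^sup>1\<close>.\<close>
lemma nonsingular_psd_coercive:
  assumes sym: "\<And>i j. i < p \<Longrightarrow> j < p \<Longrightarrow> A i j = A j i"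
    and psd: "\<And>v. 0 \<le> qform p A v" and ns: "nonsingular p A"
  obtains c where "c > 0" "\<And>v. c * dotp p v v \<le> qform p A v"
proof -
  obtain C where C: "\<And>v i. i < p \<Longrightarrow> mv p A (mv p C v) i = v i"
    using nonsingular_inverse[OF ns] by blast
  \<comment> \<open>K dominates the sum of the absolute entries of C; the added 1 keeps it positive
    even when all entries vanish.\<close>
  define K where "K = 1 + (\<Sum>i<p. \<Sum>j<p. \<bar>C i j\<bar>)"
  have K: "K > 0" unfolding K_def by (intro add_pos_nonneg sum_nonneg) auto
  have "1 / K * dotp p v v \<le> qform p A v" for v
  proof -
    define w where "w = mv p C v"
    \<comment> \<open>As A w = v, every product with \<open>mv p A w\<close> becomes one with v, so
      that w survives only in the product of v and w.\<close>
    have Aw: "dotp p u (mv p A w) = dotp p u v" for u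
      unfolding dotp_def w_def by (intro sum.cong) (auto simp: C)
    have "dotp p v w \<le> (\<Sum>i<p. \<Sum>j<p. \<bar>C i j\<bar> * dotp p v v)"
    proof -
      have "v i * (C i j * v j) \<le> \<bar>C i j\<bar> * dotp p v v" if ij: "i < p" "j < p" for i j
      proof -
      have "v i * (C i j * v j) \<le> \<bar>C i j\<bar> * \<bar>v i * v j\<bar>"
        by (metis abs_ge_self abs_mult mult.left_commute)
      also have "\<bar>v i * v j\<bar> \<le> dotp p v v"
      proof -
        have "2 * \<bar>v i * v j\<bar> \<le> v i * v i + v j * v j"
          using sum_squares_bound[of "\<bar>v i\<bar>" "\<bar>v j\<bar>"] by (simp add: abs_mult power2_eq_square)
        with component_le_dotp_self[of i p v] component_le_dotp_self[of j p v] ij show ?thesis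
          by simp
      qed
      then have "\<bar>C i j\<bar> * \<bar>v i * v j\<bar> \<le> \<bar>C i j\<bar> * dotp p v v"
        by (rule mult_left_mono) simp
      finally show ?thesis .
      qed
      then have "(\<Sum>i<p. \<Sum>j<p. v i * (C i j * v j)) \<le> (\<Sum>i<p. \<Sum>j<p. \<bar>C i j\<bar> * dotp p v v)"
        by (intro sum_mono) auto
      moreover have "dotp p v w = (\<Sum>i<p. \<Sum>j<p. v i * (C i j * v j))"
        by (simp add: dotp_def w_def mv_def sum_distrib_left)
      ultimately show ?thesis by simp
    qed
    also have "\<dots> \<le> K * dotp p v v"
      unfolding K_def using dotp_self_nonneg[of p v] by (simp add: sum_distrib_right[symmetric] distrib_right)
    finally have vw: "dotp p v w \<le> K * dotp p v v" .
    \<comment> \<open>With s = 1 / K the term quadratic in s is at most s times the squared norm of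
      v, so it absorbs only half of the linear term.\<close>
    define s where "s = 1 / K"
    have "0 \<le> qform p A (\<lambda>i. v i - s * w i)" by (rule psd)
    also have "\<dots> = qform p A v - s * dotp p v (mv p A w) - s * (dotp p w (mv p A v) - s * dotp p w (mv p A w))"
      by (simp add: qform_eq_dotp mv_diff_scaleR dotp_diff_scaleR_left dotp_diff_scaleR_right)
    also have "dotp p w (mv p A v) = dotp p v (mv p A w)"
    proof -
      have "dotp p w (mv p A v) = dotp p (mv p A w) v"
        by (rule dotp_mv_sym) (rule sym)
      then show ?thesis by (simp only: dotp_commute[of p v])
    qed
    finally have "0 \<le> qform p A v - 2 * s * dotp p v v + s * (s * dotp p v w)"
      by (simp add: Aw dotp_commute algebra_simps)
    moreover have "s * (s * dotp p v w) \<le> s * dotp p v v"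
    proof (rule mult_left_mono)
      show "s * dotp p v w \<le> dotp p v v"
        using vw K unfolding s_def by (simp add: field_simps)
    qed (use K in \<open>simp add: s_def\<close>)
    ultimately have "s * dotp p v v \<le> qform p A v" by (simp add: algebra_simps)
    then show ?thesis by (simp add: s_def)
  qed
  with K show ?thesis by (intro that[of "1 / K"]) auto
qed

lemma qform_shift:
  "qform p (\<lambda>i j. A i j - (if i = j then t else 0)) v = qform p A v - t * dotp p v v"
proof -
  have "qform p (\<lambda>i j. A i j - (if i = j then t else 0)) v
      = (\<Sum>i<p. \<Sum>j<p. v i * A i j * v j - (if i = j then t * (v i * v i) else 0))"
    unfolding qform_def by (intro sum.cong) (auto simp: algebra_simps)
  also have "\<dots> = qform p A v - t * dotp p v v"
    by (simp add: sum_subtractf qform_def dotp_def sum_distrib_left)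
  finally show ?thesis .
qed

lemma eigenvalue_qform:
  assumes "is_eigenvalue p A l"
  obtains v where "dotp p v v > 0" "qform p A v = l * dotp p v v" "\<And>i. i < p \<Longrightarrow> mv p A v i = l * v i"
proof -
  from assms obtain v where v: "\<exists>i<p. v i \<noteq> 0" "\<forall>i<p. mv p A v i = l * v i"
    unfolding is_eigenvalue_def mv_def by blast
  have "dotp p v v > 0"
    using v(1) dotp_self_nonneg[of p v] dotp_self_eq_0[of p v] by (auto simp: less_le)
  moreover have "qform p A v = l * dotp p v v"
    using v(2) by (auto simp: qform_eq_dotp dotp_def sum_distrib_left intro!: sum.cong)
  ultimately show ?thesis using v(2) that by blast
qed

text \<open>At the largest \<open>t\<close> for which \<open>A - t I\<close> is positive semidefinite, \<open>A - t I\<close> is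
  singular by coercivity, so that \<open>t\<close> is an eigenvalue.\<close>
lemma Rayleigh_eigenvalue:
  assumes sym: "\<And>i j. i < p \<Longrightarrow> j < p \<Longrightarrow> A i j = A j i"
    and psd: "\<And>v. 0 \<le> qform p A v" and p: "0 < p"
  obtains t where "is_eigenvalue p A t" "\<And>v. t * dotp p v v \<le> qform p A v"
proof -
  define T where "T = {t. \<forall>v. t * dotp p v v \<le> qform p A v}"
  define e where "e = (\<lambda>i::nat. if i = 0 then 1 else 0::real)"
  have e: "dotp p e e = 1"
  proof -
    have "dotp p e e = (\<Sum>i<p. if i = 0 then 1 else 0)"
      unfolding dotp_def e_def by (intro sum.cong) auto
    with p show ?thesis by simp
  qed
  have bdd: "bdd_above T"
  proof (rule bdd_aboveI)
    fix t assume "t \<in> T"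
    then have "t * dotp p e e \<le> qform p A e" unfolding T_def by blast
    with e show "t \<le> qform p A e" by simp
  qed
  have ne: "T \<noteq> {}" using psd by (auto simp: T_def intro!: exI[of _ 0])
  define t where "t = Sup T"
  \<comment> \<open>The supremum itself lies in \<open>T\<close>: for nonzero v the Rayleigh
    quotient of v is an upper bound of \<open>T\<close>.\<close>
  have tT: "t * dotp p v v \<le> qform p A v" for v
  proof (cases "dotp p v v = 0")
    case True then show ?thesis using psd by simp
  next
    case False
    then have pos: "dotp p v v > 0" using dotp_self_nonneg[of p v] by simp
    have "t \<le> qform p A v / dotp p v v"
      unfolding t_def by (rule cSup_least[OF ne]) (use pos in \<open>auto simp: T_def field_simps\<close>)
    then show ?thesis using pos by (simp add: field_simps)
  qed
  let ?A = "\<lambda>i j. A i j - (if i = j then t else 0)"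
  have "\<not> nonsingular p ?A"
  proof
    assume ns: "nonsingular p ?A"
    obtain c where c: "c > 0" "\<And>v. c * dotp p v v \<le> qform p ?A v"
    proof (rule nonsingular_psd_coercive[OF _ _ ns])
      show "?A i j = ?A j i" if "i < p" "j < p" for i j using sym[OF that] by simp
      show "0 \<le> qform p ?A v" for v using tT[of v] by (simp add: qform_shift)
    qed blast
    have "t + c \<in> T" using c(2) by (auto simp: T_def qform_shift algebra_simps)
    then have "t + c \<le> t" unfolding t_def by (rule cSup_upper[OF _ bdd])
    with c(1) show False by simp
  qed
  then obtain v where v: "\<forall>i<p. (\<Sum>j<p. ?A i j * v j) = 0" "\<exists>i<p. v i \<noteq> 0"
    unfolding nonsingular_def by blast
  have "(\<Sum>j<p. A i j * v j) = t * v i" if "i < p" for i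
  proof -
    have "(\<Sum>j<p. ?A i j * v j) = (\<Sum>j<p. A i j * v j - (if i = j then t * v i else 0))"
      by (intro sum.cong) (auto simp: algebra_simps)
    also have "\<dots> = (\<Sum>j<p. A i j * v j) - t * v i"
      using that by (simp add: sum_subtractf)
    finally show ?thesis using v(1) that by simp
  qed
  with v(2) have "is_eigenvalue p A t" unfolding is_eigenvalue_def by blast
  then show ?thesis using tT that by blast
qed

text \<open>Some eigenvalue t already bounds the form from below, and the minimum is at most t. This
  avoids diagonalising A.\<close>

lemma min_eigenvalue_Rayleigh:
  assumes sym: "\<And>i j. i < p \<Longrightarrow> j < p \<Longrightarrow> A i j = A j i"
    and psd: "\<And>v. 0 \<le> qform p A v" and p: "0 < p"
  shows "min_eigenvalue p A * dotp p v v \<le> qform p A v"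
proof -
  obtain t where t: "is_eigenvalue p A t" "\<And>v. t * dotp p v v \<le> qform p A v"
    using Rayleigh_eigenvalue[OF sym psd p] by blast
  have "min_eigenvalue p A \<le> t"
    unfolding min_eigenvalue_def using t(1) finite_eigenvalues by (intro Min_le) auto
  then have "min_eigenvalue p A * dotp p v v \<le> t * dotp p v v"
    using dotp_self_nonneg by (rule mult_right_mono)
  with t(2)[of v] show ?thesis by linarith
qed

text \<open>The set of eigenvalues is finite and nonempty, so its minimum is an eigenvalue. Its
  eigenvector shows that it is not negative by semidefiniteness and not zero by
  nonsingularity.\<close>

lemma min_eigenvalue_pos:
  assumes sym: "\<And>i j. i < p \<Longrightarrow> j < p \<Longrightarrow> A i j = A j i"
    and psd: "\<And>v. 0 \<le> qform p A v" and p: "0 < p" and ns: "nonsingular p A"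
  shows "min_eigenvalue p A > 0"
proof -
  obtain t where "is_eigenvalue p A t" using Rayleigh_eigenvalue[OF sym psd p] by blast
  then have "min_eigenvalue p A \<in> {l. is_eigenvalue p A l}"
    unfolding min_eigenvalue_def using finite_eigenvalues by (intro Min_in) auto
  then obtain v where v: "dotp p v v > 0" "qform p A v = min_eigenvalue p A * dotp p v v"
    "\<And>i. i < p \<Longrightarrow> mv p A v i = min_eigenvalue p A * v i"
    using eigenvalue_qform by blast
  have "min_eigenvalue p A \<noteq> 0"
  proof
    assume "min_eigenvalue p A = 0"
    with v(3) ns have "\<forall>i<p. v i = 0" unfolding nonsingular_def mv_def by simp
    with v(1) dotp_self_eq_0[of p v] show False by simp
  qed
  moreover have "0 \<le> min_eigenvalue p A * dotp p v v" using psd[of v] v(2) by simp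
  ultimately show ?thesis using v(1) by (simp add: zero_le_mult_iff less_le)
qed

section \<open>The population regression vector and the direction \<open>Theta1\<close>\<close>

lemma sum_lessThan_split_0:
  fixes f :: "nat \<Rightarrow> real"
  assumes "0 < p"
  shows "(\<Sum>j<p. f j) = f 0 + (\<Sum>j\<in>{1..<p}. f j)"
  using assms by (simp add: lessThan_atLeast0 sum.atLeast_Suc_lessThan)

text \<open>\<open>gamma0\<close> is a definite description, so existence and uniqueness are both
  due. A solution is read off from the first column of the inverse of A; uniqueness follows from
  coercivity of A on vectors that vanish at index 0.\<close>

lemma gamma0_solves:
  assumes sym: "\<And>i j. i < p \<Longrightarrow> j < p \<Longrightarrow> A i j = A j i"
    and psd: "\<And>v. 0 \<le> qform p A v" and p: "0 < p" and ns: "nonsingular p A"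
    and i: "i \<in> {1..<p}"
  shows "(\<Sum>j\<in>{1..<p}. A i j * gamma0 p A j) = A i 0"
proof -
  obtain c where c: "c > 0" "\<And>v. c * dotp p v v \<le> qform p A v"
    using nonsingular_psd_coercive[OF sym psd ns] by blast
  obtain C where C: "\<And>v i. i < p \<Longrightarrow> mv p A (mv p C v) i = v i"
    using nonsingular_inverse[OF ns] by blast
  define e where "e = (\<lambda>i::nat. if i = 0 then 1 else 0::real)"
  define h where "h = mv p C e"
  have h: "mv p A h i = e i" if "i < p" for i using C that by (simp add: h_def)
  \<comment> \<open>Since A h is the first unit vector, h 0 equals the quadratic form at h, which is
    positive because h is nonzero.\<close>
  have "h 0 > 0"
  proof -
    have "qform p A h = (\<Sum>i<p. if i = 0 then h 0 else 0)"
      unfolding qform_eq_dotp dotp_def by (intro sum.cong) (auto simp: h e_def)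
    then have q: "qform p A h = h 0" using p by simp
    have "dotp p h h \<noteq> 0"
    proof
      assume "dotp p h h = 0"
      then have "mv p A h 0 = 0" by (simp add: dotp_self_eq_0 mv_def)
      with h[OF p] show False by (simp add: e_def)
    qed
    then have "c * dotp p h h > 0" using c(1) dotp_self_nonneg[of p h] by simp
    with c(2)[of h] q show ?thesis by simp
  qed
  \<comment> \<open>Scaling h to first entry 1 gives the vector (1, -g) that A annihilates at all
    indices but 0; these are the equations for g.\<close>
  define g where "g = (\<lambda>j. if j \<in> {1..<p} then - h j / h 0 else 0)"
  let ?P = "\<lambda>g. (\<forall>i\<in>{1..<p}. (\<Sum>j\<in>{1..<p}. A i j * g j) = A i 0) \<and> (\<forall>j. j \<notin> {1..<p} \<longrightarrow> g j = 0)"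
  have "?P g"
  proof (intro conjI ballI allI impI)
    fix i assume i: "i \<in> {1..<p}"
    have "A i 0 * h 0 + (\<Sum>j\<in>{1..<p}. A i j * h j) = 0"
      using h[of i] i sum_lessThan_split_0[OF p, of "\<lambda>j. A i j * h j"] by (simp add: mv_def e_def)
    then have "- (\<Sum>j\<in>{1..<p}. A i j * h j) / h 0 = A i 0" using \<open>h 0 > 0\<close> by (simp add: field_simps)
    moreover have "(\<Sum>j\<in>{1..<p}. A i j * g j) = - (\<Sum>j\<in>{1..<p}. A i j * h j) / h 0"
      by (simp add: g_def sum_divide_distrib sum_negf[symmetric])
    ultimately show "(\<Sum>j\<in>{1..<p}. A i j * g j) = A i 0" by simp
  qed (auto simp: g_def)
  \<comment> \<open>The difference v is zero at index 0 and A v is zero elsewhere, so the form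
    vanishes at v whatever the entry of A v at 0.\<close>
  moreover have "g' = g''" if g': "?P g'" and g'': "?P g''" for g' g''
  proof -
    define v where "v = (\<lambda>j. g' j - g'' j)"
    have v0: "v 0 = 0" using g' g'' by (simp add: v_def)
    have "mv p A v i = 0" if i: "i \<in> {1..<p}" for i
    proof -
      have "mv p A v i = (\<Sum>j\<in>{1..<p}. A i j * v j)"
        using sum_lessThan_split_0[OF p, of "\<lambda>j. A i j * v j"] v0 by (simp add: mv_def)
      also have "\<dots> = (\<Sum>j\<in>{1..<p}. A i j * g' j) - (\<Sum>j\<in>{1..<p}. A i j * g'' j)"
        by (simp add: v_def algebra_simps sum_subtractf)
      also have "\<dots> = 0" using g' g'' i by simp
      finally show ?thesis .
    qed
    then have "qform p A v = 0"
      unfolding qform_eq_dotp dotp_def sum_lessThan_split_0[OF p] using v0 by simp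
    with c(2)[of v] have "c * dotp p v v \<le> 0" by simp
    then have "dotp p v v = 0"
      using c(1) dotp_self_nonneg[of p v] by (simp add: mult_le_0_iff)
    then have "\<forall>i<p. g' i = g'' i" by (simp add: dotp_self_eq_0 v_def)
    moreover have "g' i = g'' i" if "\<not> i < p" for i using g' g'' that by simp
    ultimately show ?thesis by blast
  qed
  ultimately have "?P (gamma0 p A)"
    unfolding gamma0_def by (intro theI[of ?P g]) blast+
  with i show ?thesis by blast
qed

text \<open>Put v = (1, -g), so that T = v / D. The normal equations make D the first entry of A v,
  and eligibility bounds the other entries by l. Pairing A v with v, Hoelder's inequality shows that
  D differs from the quadratic form at v by at most d, so D inherits the eigenvalue bound up to
  d.\<close>

lemma Theta1_bounds:
  assumes sym: "\<And>i j. i < p \<Longrightarrow> j < p \<Longrightarrow> A i j = A j i"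
    and psd: "\<And>v. 0 \<le> qform p A v" and p: "0 < p" and ns: "nonsingular p A"
    and diag: "A 0 0 = 1"
    and elig: "\<And>i. i \<in> {1..<p} \<Longrightarrow> \<bar>\<Sum>j\<in>{1..<p}. A i j * (g j - gamma0 p A j)\<bar> \<le> l"
    and small: "l * (\<Sum>j\<in>{1..<p}. \<bar>g j\<bar>) < min_eigenvalue p A"
  defines "d \<equiv> l * (\<Sum>j\<in>{1..<p}. \<bar>g j\<bar>)" and "T \<equiv> Theta1 p A g"
  shows "T 0 > 0" "1 / T 0 \<ge> min_eigenvalue p A - d"
    "mv p A T 0 = 1" "\<And>i. i \<in> {1..<p} \<Longrightarrow> \<bar>mv p A T i\<bar> \<le> l * T 0"
    "\<bar>qform p A T / T 0 - 1\<bar> \<le> d * T 0" "1 \<le> qform p A T"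
proof -
  define D where "D = 1 - (\<Sum>i\<in>{1..<p}. \<Sum>k\<in>{1..<p}. gamma0 p A i * A i k * g k)"
  define v where "v = (\<lambda>j. if j = 0 then 1 else if j < p then - g j else 0)"
  have T: "T j = v j / D" for j by (simp add: T_def Theta1_def D_def v_def)
  have g0: "(\<Sum>j\<in>{1..<p}. A i j * gamma0 p A j) = A i 0" if "i \<in> {1..<p}" for i
    by (rule gamma0_solves[OF sym psd p ns that])
  have "(\<Sum>i\<in>{1..<p}. \<Sum>k\<in>{1..<p}. gamma0 p A i * A i k * g k)
      = (\<Sum>k\<in>{1..<p}. \<Sum>i\<in>{1..<p}. gamma0 p A i * A i k * g k)" by (rule sum.swap)
  \<comment> \<open>By symmetry the normal equations of \<open>gamma0\<close> can be applied inside
    the bilinear form, which removes \<open>gamma0\<close> from D.\<close>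
  also have "\<dots> = (\<Sum>k\<in>{1..<p}. A 0 k * g k)"
  proof (rule sum.cong)
    fix k assume k: "k \<in> {1..<p}"
    have "(\<Sum>i\<in>{1..<p}. gamma0 p A i * A i k * g k) = (\<Sum>i\<in>{1..<p}. A k i * gamma0 p A i) * g k"
      unfolding sum_distrib_right using k by (intro sum.cong) (auto simp: sym[of k])
    also have "\<dots> = A 0 k * g k" using g0[OF k] sym[of k 0] k by simp
    finally show "(\<Sum>i\<in>{1..<p}. gamma0 p A i * A i k * g k) = A 0 k * g k" .
  qed simp
  finally have D: "D = 1 - (\<Sum>k\<in>{1..<p}. A 0 k * g k)" by (simp add: D_def)
  have mv0: "mv p A v 0 = D"
    unfolding mv_def sum_lessThan_split_0[OF p] D by (simp add: v_def diag sum_negf)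
  have mvi: "\<bar>mv p A v i\<bar> \<le> l" if i: "i \<in> {1..<p}" for i
  proof -
    have "mv p A v i = A i 0 - (\<Sum>k\<in>{1..<p}. A i k * g k)"
      unfolding mv_def sum_lessThan_split_0[OF p] by (simp add: v_def sum_negf)
    also have "\<dots> = - (\<Sum>j\<in>{1..<p}. A i j * (g j - gamma0 p A j))"
      using g0[OF i] by (simp add: algebra_simps sum_subtractf)
    finally show ?thesis using elig[OF i] by simp
  qed
  have q: "qform p A v = D - (\<Sum>i\<in>{1..<p}. g i * mv p A v i)"
    unfolding qform_eq_dotp dotp_def sum_lessThan_split_0[OF p] mv0
    by (simp add: v_def[of] sum_negf)
  have qD: "\<bar>qform p A v - D\<bar> \<le> d"
  proof -
    have "\<bar>\<Sum>i\<in>{1..<p}. g i * mv p A v i\<bar> \<le> (\<Sum>i\<in>{1..<p}. \<bar>g i * mv p A v i\<bar>)" by (rule sum_abs)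
    also have "\<dots> \<le> (\<Sum>i\<in>{1..<p}. \<bar>g i\<bar> * l)"
      by (intro sum_mono) (auto simp: abs_mult intro!: mult_left_mono mvi)
    also have "\<dots> = d" by (simp add: d_def sum_distrib_left mult.commute)
    finally show ?thesis by (simp add: q)
  qed
  \<comment> \<open>The first entry of v is 1, so the eigenvalue bound needs no information on
    g.\<close>
  have "1 \<le> dotp p v v" using component_le_dotp_self[OF p, of v] by (simp add: v_def)
  then have "min_eigenvalue p A * 1 \<le> min_eigenvalue p A * dotp p v v"
    using min_eigenvalue_pos[OF sym psd p ns] by (intro mult_left_mono) auto
  also have "\<dots> \<le> qform p A v" by (rule min_eigenvalue_Rayleigh[OF sym psd p])
  finally have Dlow: "D \<ge> min_eigenvalue p A - d" using qD by linarith
  with small have Dpos: "D > 0" by (simp add: d_def)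
  have T0: "T 0 = 1 / D" by (simp add: T v_def)
  have mvT: "mv p A T i = mv p A v i / D" for i by (simp add: mv_def T sum_divide_distrib)
  have qT: "qform p A T = qform p A v / D\<^sup>2"
    by (simp add: qform_def T sum_divide_distrib power2_eq_square)
  show "T 0 > 0" "1 / T 0 \<ge> min_eigenvalue p A - d" and mvT0: "mv p A T 0 = 1"
    using Dpos Dlow by (auto simp: T0 mvT mv0)
  \<comment> \<open>For the last claim the form is expanded at T - e with e the first unit vector.
    As (A T) 0 = 1 and A 0 0 = 1, it equals the form at T minus 1, and it is nonnegative.\<close>
  define e where "e = (\<lambda>i::nat. if i = 0 then 1 else 0::real)"
  have e: "dotp p e u = u 0" "dotp p u e = u 0" for u
    unfolding dotp_def sum_lessThan_split_0[OF p] by (simp_all add: e_def)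
  have "mv p A e 0 = 1"
    unfolding mv_def sum_lessThan_split_0[OF p] by (simp add: e_def diag)
  moreover have "dotp p T (mv p A e) = dotp p (mv p A T) e"
    by (rule dotp_mv_sym) (rule sym)
  ultimately have "qform p A (\<lambda>i. T i - 1 * e i) = qform p A T - 1"
    unfolding qform_eq_dotp mv_diff_scaleR dotp_diff_scaleR_left dotp_diff_scaleR_right
    by (simp add: e mvT0)
  with psd[of "\<lambda>i. T i - 1 * e i"] show "1 \<le> qform p A T" by simp
  show "\<bar>mv p A T i\<bar> \<le> l * T 0" if "i \<in> {1..<p}" for i
    using mvi[OF that] Dpos by (simp add: mvT T0 divide_right_mono)
  have "qform p A T / T 0 - 1 = (qform p A v - D) / D"
    using Dpos by (simp add: qT T0 power2_eq_square field_simps)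
  then show "\<bar>qform p A T / T 0 - 1\<bar> \<le> d * T 0"
    using qD Dpos by (simp add: T0 divide_right_mono)
qed

subsection \<open>Gaussian arrays\<close>

lemma std_normal_prob_space: "prob_space std_normal_distribution"
  by (rule prob_space_normal_density) simp

lemma std_normal_product_prob_space: "product_prob_space (\<lambda>_. std_normal_distribution)"
  by (rule product_prob_spaceI) (rule std_normal_prob_space)

lemma prob_space_PiM_std_normal: "prob_space (PiM J (\<lambda>_. std_normal_distribution))"
  by (rule prob_space_PiM) (rule std_normal_prob_space)

lemma borel_measurable_PiM_std_normal_component:
  "k \<in> J \<Longrightarrow> (\<lambda>\<omega>. \<omega> k) \<in> borel_measurable (PiM J (\<lambda>_. std_normal_distribution))"
  using measurable_component_singleton[of k J "\<lambda>_. std_normal_distribution"]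
  by (simp add: measurable_cong_sets[OF refl sets_density])

text \<open>The normal law has a density and hence no atoms. Continuity turns weak convergence into
  convergence at every z and later absorbs small shifts of z.\<close>

lemma isCont_Phi: "isCont Phi z"
proof -
  interpret real_distribution std_normal_distribution by (rule real_dist_normal_dist)
  have "emeasure std_normal_distribution {z} = 0"
    by (subst emeasure_density) (auto intro!: nn_integral_null_set)
  then show ?thesis unfolding Phi_def by (simp add: isCont_cdf measure_def)
qed

text \<open>Independence means that the joint law is the product of the marginals. Points of the
  product space are extensional, so the joint map is the identity. The criterion is for nonempty
  families, whence the case split.\<close>

lemma indep_vars_PiM_components:
  assumes "\<And>i. prob_space (M i)"
  shows "prob_space.indep_vars (PiM J M) M (\<lambda>i \<omega>. \<omega> i) J"
proof -
  interpret P: prob_space "PiM J M" by (rule prob_space_PiM) (rule assms)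
  show ?thesis
  proof (cases "J = {}")
    case True
    have "P.indep_vars M (\<lambda>i \<omega>. \<omega> i) {}" by (simp add: P.indep_vars_def P.indep_sets_def)
    with True show ?thesis by simp
  next
    case False
    have "distr (PiM J M) (PiM J M) (\<lambda>x. \<lambda>i\<in>J. x i) = distr (PiM J M) (PiM J M) (\<lambda>x. x)"
      by (rule distr_cong) (auto simp: space_PiM PiE_def extensional_restrict)
    also have "\<dots> = PiM J (\<lambda>i. distr (PiM J M) (M i) (\<lambda>\<omega>. \<omega> i))"
      by (simp add: distr_id2 distr_PiM_component assms cong: PiM_cong)
    finally show ?thesis
      by (subst P.indep_vars_iff_distr_eq_PiM'[OF False]) auto
  qed
qed

text \<open>Composing with \<open>restrict\<close> expresses that f j reads only the coordinates in
  the block K j; disjoint blocks of independent coordinates are independent.\<close>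

lemma indep_vars_PiM_blocks:
  assumes M: "\<And>i. prob_space (M i)"
    and K: "\<And>j. j \<in> L \<Longrightarrow> K j \<subseteq> J" "disjoint_family_on K L"
    and f: "\<And>j. j \<in> L \<Longrightarrow> f j \<in> measurable (PiM (K j) M) (N j)"
  shows "prob_space.indep_vars (PiM J M) N (\<lambda>j \<omega>. f j (restrict \<omega> (K j))) L"
proof -
  interpret P: prob_space "PiM J M" by (rule prob_space_PiM) (rule M)
  show ?thesis
    by (rule P.indep_vars_compose2[OF P.indep_vars_restrict[OF indep_vars_PiM_components[OF M] K], of f])
       (auto intro: f)
qed

text \<open>This replaces conditioning on the coordinates in J: by Fubini, a bound valid for every
  frozen y integrates to the same bound.\<close>

lemma PiM_prob_le_sections:
  assumes "product_prob_space M" and JK: "J \<inter> K = {}" "finite J" "finite K"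
    and A: "A \<in> sets (PiM (J \<union> K) M)"
    and le: "\<And>y. y \<in> space (PiM J M) \<Longrightarrow>
      measure (PiM K M) {x \<in> space (PiM K M). merge J K (y, x) \<in> A} \<le> c"
  shows "measure (PiM (J \<union> K) M) A \<le> c"
proof -
  interpret product_prob_space M by fact
  interpret JK: prob_space "PiM (J \<union> K) M" by (rule prob_space_PiM) (rule prob_space)
  interpret J: prob_space "PiM J M" by (rule prob_space_PiM) (rule prob_space)
  interpret K: prob_space "PiM K M" by (rule prob_space_PiM) (rule prob_space)
  \<comment> \<open>One section suffices for c to be nonnegative, so that \<open>ennreal c\<close>
    can be turned back into c at the end.\<close>
  obtain y0 where "y0 \<in> space (PiM J M)" using J.not_empty by blast
  then have c: "0 \<le> c" using le[of y0] by (meson measure_nonneg order_trans)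
  have "emeasure (PiM (J \<union> K) M) A = (\<integral>\<^sup>+\<omega>. indicator A \<omega> \<partial>PiM (J \<union> K) M)"
    using A by simp
  also have "\<dots> = (\<integral>\<^sup>+y. (\<integral>\<^sup>+x. indicator A (merge J K (y, x)) \<partial>PiM K M) \<partial>PiM J M)"
    using A by (intro product_nn_integral_fold JK) simp
  also have "\<dots> \<le> (\<integral>\<^sup>+y. ennreal c \<partial>PiM J M)"
  proof (rule nn_integral_mono)
    fix y assume y: "y \<in> space (PiM J M)"
    have m: "(\<lambda>x. merge J K (y, x)) \<in> measurable (PiM K M) (PiM (J \<union> K) M)"
      using y by measurable
    have "(\<integral>\<^sup>+x. indicator A (merge J K (y, x)) \<partial>PiM K M)
        = (\<integral>\<^sup>+x. indicator {x \<in> space (PiM K M). merge J K (y, x) \<in> A} x \<partial>PiM K M)"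
      by (intro nn_integral_cong) (auto simp: indicator_def)
    also have "\<dots> = emeasure (PiM K M) {x \<in> space (PiM K M). merge J K (y, x) \<in> A}"
      using measurable_sets[OF m A] by (intro nn_integral_indicator) (simp add: vimage_def Int_def conj_commute)
    also have "\<dots> \<le> ennreal c"
      using le[OF y] by (simp add: K.emeasure_eq_measure ennreal_leI)
    finally show "(\<integral>\<^sup>+x. indicator A (merge J K (y, x)) \<partial>PiM K M) \<le> ennreal c" .
  qed
  also have "\<dots> = ennreal c" by (simp add: J.emeasure_space_1)
  finally show ?thesis using c by (simp add: JK.emeasure_eq_measure)
qed

section \<open>Laws identified by characteristic functions, and moments\<close>

lemma (in prob_space) char_distr_mult:
  assumes [measurable]: "random_variable borel Z"
  shows "char (distr M borel (\<lambda>\<omega>. a * Z \<omega>)) t = char (distr M borel Z) (a * t)"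
proof -
  have "char (distr M borel (\<lambda>\<omega>. a * Z \<omega>)) t = (CLINT \<omega>|M. iexp (t * (a * Z \<omega>)))"
    unfolding char_def by (subst integral_distr) auto
  also have "\<dots> = (CLINT \<omega>|M. iexp (a * t * Z \<omega>))"
    by (simp only: mult.assoc mult.left_commute[of t a])
  also have "\<dots> = char (distr M borel Z) (a * t)"
    unfolding char_def by (subst integral_distr) auto
  finally show ?thesis .
qed

lemma distr_eqI_char:
  assumes "prob_space M" "prob_space N" "X \<in> borel_measurable M" "Y \<in> borel_measurable N"
    and "\<And>t. char (distr M borel X) t = char (distr N borel Y) t"
  shows "distr M borel X = distr N borel Y"
proof (rule Levy_uniqueness)
  show "real_distribution (distr M borel X)" "real_distribution (distr N borel Y)"
    using assms by (auto intro: prob_space.real_distribution_distr)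
  show "char (distr M borel X) = char (distr N borel Y)"
    by (rule ext) (rule assms)
qed

text \<open>The two families may live on different spaces. Their sums are compared through
  characteristic functions, which factor over the index set.\<close>

lemma distr_sum_indep_eq:
  fixes X :: "'i \<Rightarrow> 'a \<Rightarrow> real" and Y :: "'i \<Rightarrow> 'b \<Rightarrow> real"
  assumes "prob_space M" "prob_space N"
    and X: "prob_space.indep_vars M (\<lambda>_. borel) X I" and Y: "prob_space.indep_vars N (\<lambda>_. borel) Y I"
    and eq: "\<And>i. i \<in> I \<Longrightarrow> distr M borel (X i) = distr N borel (Y i)"
  shows "distr M borel (\<lambda>\<omega>. \<Sum>i\<in>I. X i \<omega>) = distr N borel (\<lambda>\<omega>. \<Sum>i\<in>I. Y i \<omega>)"
proof -
  interpret M: prob_space M by fact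
  interpret N: prob_space N by fact
  show ?thesis
  proof (rule distr_eqI_char)
    show "(\<lambda>\<omega>. \<Sum>i\<in>I. X i \<omega>) \<in> borel_measurable M" "(\<lambda>\<omega>. \<Sum>i\<in>I. Y i \<omega>) \<in> borel_measurable N"
      using X Y by (auto simp: M.indep_vars_def2 N.indep_vars_def2 intro!: borel_measurable_sum)
    show "char (distr M borel (\<lambda>\<omega>. \<Sum>i\<in>I. X i \<omega>)) t = char (distr N borel (\<lambda>\<omega>. \<Sum>i\<in>I. Y i \<omega>)) t" for t
      using M.char_distr_sum[OF X, of t] N.char_distr_sum[OF Y, of t] eq by simp
  qed fact+
qed

text \<open>The law is written as that of a multiple of a standard normal rather than by a normal
  density, so that variance zero is covered as well.\<close>

lemma (in prob_space) distr_std_normal_lincomb: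
  assumes Z: "indep_vars (\<lambda>_. borel) Z K"
    and N: "\<And>k. k \<in> K \<Longrightarrow> distr M borel (Z k) = std_normal_distribution"
  shows "distr M borel (\<lambda>\<omega>. \<Sum>k\<in>K. a k * Z k \<omega>)
    = distr std_normal_distribution borel (\<lambda>x. sqrt (\<Sum>k\<in>K. a k * a k) * x)"
proof -
  interpret N: prob_space std_normal_distribution by (rule std_normal_prob_space)
  have rv: "random_variable borel (Z k)" if "k \<in> K" for k
    using Z that by (auto simp: indep_vars_def2)
  have id: "distr std_normal_distribution borel (\<lambda>x. x) = std_normal_distribution"
    by (rule distr_id2) simp
  show ?thesis
  proof (rule distr_eqI_char[OF _ std_normal_prob_space])
    show "prob_space M" by (rule prob_space_axioms)
    show "(\<lambda>\<omega>. \<Sum>k\<in>K. a k * Z k \<omega>) \<in> borel_measurable M"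
      using rv by (intro borel_measurable_sum borel_measurable_times) auto
    show "(\<lambda>x. sqrt (\<Sum>k\<in>K. a k * a k) * x) \<in> borel_measurable std_normal_distribution" by simp
    fix t
    have "char (distr M borel (\<lambda>\<omega>. \<Sum>k\<in>K. a k * Z k \<omega>)) t
        = (\<Prod>k\<in>K. char (distr M borel (\<lambda>\<omega>. a k * Z k \<omega>)) t)"
      by (intro char_distr_sum indep_vars_compose2[OF Z]) auto
    also have "\<dots> = (\<Prod>k\<in>K. complex_of_real (exp (- ((a k * t)\<^sup>2) / 2)))"
      by (intro prod.cong) (auto simp: char_distr_mult[OF rv] N char_std_normal_distribution)
    also have "\<dots> = complex_of_real (\<Prod>k\<in>K. exp (- ((a k * t)\<^sup>2) / 2))" by simp
    also have "(\<Prod>k\<in>K. exp (- ((a k * t)\<^sup>2) / 2)) = exp (- ((sqrt (\<Sum>k\<in>K. a k * a k) * t)\<^sup>2) / 2)"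
    \<comment> \<open>For infinite K, sums are 0 and products are 1 by convention, and both sides
      equal 1.\<close>
    proof (cases "finite K")
      case True
      have "(sqrt (\<Sum>k\<in>K. a k * a k))\<^sup>2 = (\<Sum>k\<in>K. a k * a k)"
        by (intro real_sqrt_pow2 sum_nonneg) simp
      then have "(sqrt (\<Sum>k\<in>K. a k * a k) * t)\<^sup>2 = (\<Sum>k\<in>K. (a k * t)\<^sup>2)"
        by (simp only: power_mult_distrib sum_distrib_right) (simp add: power2_eq_square)
      then show ?thesis
        by (simp only: exp_sum[OF True, symmetric] sum_negf sum_divide_distrib[symmetric])
    qed simp
    also have "complex_of_real \<dots> = char (distr std_normal_distribution borel (\<lambda>x. sqrt (\<Sum>k\<in>K. a k * a k) * x)) t"
      by (simp add: N.char_distr_mult id char_std_normal_distribution)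
    finally show "char (distr M borel (\<lambda>\<omega>. \<Sum>k\<in>K. a k * Z k \<omega>)) t
      = char (distr std_normal_distribution borel (\<lambda>x. sqrt (\<Sum>k\<in>K. a k * a k) * x)) t" .
  qed
qed

text \<open>Moments depend on the law only, so they are s to the k times those of the standard
  normal; the factor 3 is its fourth moment.\<close>

lemma (in prob_space)
  assumes [measurable]: "random_variable borel U"
    and U: "distr M borel U = distr std_normal_distribution borel (\<lambda>x. s * x)"
  shows scaled_normal_square: "integrable M (\<lambda>\<omega>. (U \<omega>)\<^sup>2)" "expectation (\<lambda>\<omega>. (U \<omega>)\<^sup>2) = s\<^sup>2"
    and scaled_normal_fourth: "integrable M (\<lambda>\<omega>. (U \<omega>) ^ 4)" "expectation (\<lambda>\<omega>. (U \<omega>) ^ 4) = 3 * s ^ 4"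
    and scaled_normal_mean: "expectation U = 0"
proof -
  have int: "integrable M (\<lambda>\<omega>. (U \<omega>) ^ k)" for k
  proof -
    have "integrable (distr M borel U) (\<lambda>x. x ^ k)"
      unfolding U by (subst integrable_distr_eq)
        (auto simp: power_mult_distrib integrable_std_normal_distribution_moment)
    then show ?thesis by (subst (asm) integrable_distr_eq) auto
  qed
  have ex: "expectation (\<lambda>\<omega>. (U \<omega>) ^ k) = s ^ k * (LINT x|std_normal_distribution. x ^ k)" for k
  proof -
    have "expectation (\<lambda>\<omega>. (U \<omega>) ^ k) = (LINT x|distr M borel U. x ^ k)"
      by (simp add: integral_distr)
    also have "\<dots> = s ^ k * (LINT x|std_normal_distribution. x ^ k)"
      unfolding U by (simp add: integral_distr power_mult_distrib)
    finally show ?thesis .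
  qed
  show "integrable M (\<lambda>\<omega>. (U \<omega>)\<^sup>2)" "integrable M (\<lambda>\<omega>. (U \<omega>) ^ 4)" by (rule int)+
  show "expectation (\<lambda>\<omega>. (U \<omega>)\<^sup>2) = s\<^sup>2"
    using std_normal_distribution_even_moments(1)[of 1] by (simp add: ex)
  show "expectation (\<lambda>\<omega>. (U \<omega>) ^ 4) = 3 * s ^ 4"
    using std_normal_distribution_even_moments(1)[of 2] by (simp add: ex fact_numeral)
  show "expectation U = 0"
    using ex[of 1] integral_std_normal_distribution_moment_odd[of 1] by simp
qed

text \<open>By induction: the new term is independent of the remaining sum and both are centred, so
  the cross term has mean zero. Integrability is proved along with the identity because the
  induction step uses it.\<close>

lemma (in prob_space) second_moment_indep_sum:
  fixes X :: "'i \<Rightarrow> 'a \<Rightarrow> real"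
  assumes "finite I" "indep_vars (\<lambda>_. borel) X I"
    and "\<And>i. i \<in> I \<Longrightarrow> integrable M (\<lambda>\<omega>. (X i \<omega>)\<^sup>2)" and "\<And>i. i \<in> I \<Longrightarrow> expectation (X i) = 0"
  shows "integrable M (\<lambda>\<omega>. (\<Sum>i\<in>I. X i \<omega>)\<^sup>2)
    \<and> expectation (\<lambda>\<omega>. (\<Sum>i\<in>I. X i \<omega>)\<^sup>2) = (\<Sum>i\<in>I. expectation (\<lambda>\<omega>. (X i \<omega>)\<^sup>2))"
  using assms
proof (induction I)
  case (insert i I)
  let ?S = "\<lambda>\<omega>. \<Sum>i\<in>I. X i \<omega>"
  have rv: "random_variable borel (X j)" if "j \<in> insert i I" for j
    using insert.prems(1) that by (auto simp: indep_vars_def2)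
  have IH: "integrable M (\<lambda>\<omega>. (?S \<omega>)\<^sup>2)"
    "expectation (\<lambda>\<omega>. (?S \<omega>)\<^sup>2) = (\<Sum>i\<in>I. expectation (\<lambda>\<omega>. (X i \<omega>)\<^sup>2))"
    using insert.IH insert.prems indep_vars_subset[OF insert.prems(1)] by auto
  have int: "integrable M (X j)" if "j \<in> insert i I" for j
    using square_integrable_imp_integrable[OF rv[OF that]] insert.prems(2)[OF that] by simp
  have indep: "indep_var borel (X i) borel ?S"
    by (rule indep_vars_sum) (use insert in auto)
  have S: "integrable M ?S" using int by auto
  have ES: "expectation ?S = 0" using int insert.prems(3) by simp
  have XS: "integrable M (\<lambda>\<omega>. X i \<omega> * ?S \<omega>)" "expectation (\<lambda>\<omega>. X i \<omega> * ?S \<omega>) = 0"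
    using indep_var_integrable[OF indep int S] indep_var_lebesgue_integral[OF indep int S] ES by auto
  have eq: "(\<lambda>\<omega>. (\<Sum>i\<in>insert i I. X i \<omega>)\<^sup>2) = (\<lambda>\<omega>. (X i \<omega>)\<^sup>2 + 2 * (X i \<omega> * ?S \<omega>) + (?S \<omega>)\<^sup>2)"
    using insert.hyps by (auto simp: power2_sum)
  show ?case
    unfolding eq using insert.prems(2)[of i] IH XS insert.hyps by auto
qed simp

section \<open>Linear forms in the rows of a Gaussian array\<close>

definition rowlin :: "nat \<Rightarrow> (nat \<Rightarrow> real) \<Rightarrow> nat \<Rightarrow> (nat \<times> nat \<Rightarrow> real) \<Rightarrow> real" where
  "rowlin p a i \<omega> = (\<Sum>k<p. \<omega> (i, k) * a k)"

abbreviation gauss :: "(nat \<times> nat) set \<Rightarrow> (nat \<times> nat \<Rightarrow> real) measure" where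
  "gauss J \<equiv> PiM J (\<lambda>_. std_normal_distribution)"

lemma rowlin_measurable:
  "{i} \<times> {0..<p} \<subseteq> J \<Longrightarrow> rowlin p a i \<in> borel_measurable (gauss J)"
  unfolding rowlin_def[abs_def]
  by (intro borel_measurable_sum borel_measurable_times borel_measurable_PiM_std_normal_component) auto

lemma rowlin_restrict:
  "{i} \<times> {0..<p} \<subseteq> J \<Longrightarrow> rowlin p a i (restrict \<omega> J) = rowlin p a i \<omega>"
  unfolding rowlin_def by (intro sum.cong) (auto simp: subset_eq)

lemma distr_gauss_component:
  assumes "k \<in> J"
  shows "distr (gauss J) borel (\<lambda>\<omega>. \<omega> k) = std_normal_distribution"
proof -
  have "distr (gauss J) borel (\<lambda>\<omega>. \<omega> k) = distr (gauss J) std_normal_distribution (\<lambda>\<omega>. \<omega> k)"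
    by (rule distr_cong) auto
  also have "\<dots> = std_normal_distribution"
    by (rule distr_PiM_component[OF std_normal_prob_space assms])
  finally show ?thesis .
qed

lemma distr_rowlin:
  assumes "{i} \<times> {0..<p} \<subseteq> J"
  shows "distr (gauss J) borel (rowlin p a i)
    = distr std_normal_distribution borel (\<lambda>x. sqrt (dotp p a a) * x)"
proof -
  interpret prob_space "gauss J" by (rule prob_space_PiM_std_normal)
  have "indep_vars (\<lambda>_. borel) (\<lambda>k \<omega>. (\<lambda>\<omega>. \<omega> (i, k)) (restrict \<omega> {(i, k)})) {..<p}"
    using assms by (intro indep_vars_PiM_blocks[OF std_normal_prob_space]
        borel_measurable_PiM_std_normal_component) (auto simp: disjoint_family_on_def)
  then have "indep_vars (\<lambda>_. borel) (\<lambda>k \<omega>. \<omega> (i, k)) {..<p}" by simp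
  from distr_std_normal_lincomb[OF this, of a] show ?thesis
    using assms distr_gauss_component[of "(i, _)" J]
    by (simp add: rowlin_def[abs_def] dotp_def mult.commute subset_eq)
qed

text \<open>Two forms in the same row are correlated. Polarisation reduces the mean of their product
  to second moments of single forms, and a weighted AM-GM inequality reduces the second moment to
  fourth moments, so no joint law is required.\<close>

lemma rowlin_product:
  assumes J: "{i} \<times> {0..<p} \<subseteq> J"
  shows "integrable (gauss J) (\<lambda>\<omega>. rowlin p a i \<omega> * rowlin p c i \<omega>)"
    "(LINT \<omega>|gauss J. rowlin p a i \<omega> * rowlin p c i \<omega>) = dotp p a c"
    "integrable (gauss J) (\<lambda>\<omega>. (rowlin p a i \<omega> * rowlin p c i \<omega>)\<^sup>2)"
    "(LINT \<omega>|gauss J. (rowlin p a i \<omega> * rowlin p c i \<omega>)\<^sup>2) \<le> 3 * dotp p a a * dotp p c c"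
proof -
  interpret prob_space "gauss J" by (rule prob_space_PiM_std_normal)
  note [measurable] = rowlin_measurable[OF J]
  have sq: "integrable (gauss J) (\<lambda>\<omega>. (rowlin p a i \<omega>)\<^sup>2)"
      "expectation (\<lambda>\<omega>. (rowlin p a i \<omega>)\<^sup>2) = dotp p a a" for a
    using scaled_normal_square[OF rowlin_measurable[OF J] distr_rowlin[OF J], of a]
    by (simp_all add: dotp_self_nonneg)
  have fo: "integrable (gauss J) (\<lambda>\<omega>. (rowlin p a i \<omega>) ^ 4)"
      "expectation (\<lambda>\<omega>. (rowlin p a i \<omega>) ^ 4) = 3 * (dotp p a a)\<^sup>2" for a
  proof -
    have "sqrt (dotp p a a) ^ 4 = ((sqrt (dotp p a a))\<^sup>2)\<^sup>2" by simp
    also have "\<dots> = (dotp p a a)\<^sup>2" by (simp only: real_sqrt_pow2 dotp_self_nonneg)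
    finally have s: "sqrt (dotp p a a) ^ 4 = (dotp p a a)\<^sup>2" .
    show "integrable (gauss J) (\<lambda>\<omega>. (rowlin p a i \<omega>) ^ 4)"
      "expectation (\<lambda>\<omega>. (rowlin p a i \<omega>) ^ 4) = 3 * (dotp p a a)\<^sup>2"
      using scaled_normal_fourth[OF rowlin_measurable[OF J] distr_rowlin[OF J], of a]
      by (simp_all only: s)
  qed
  let ?U = "rowlin p a i" and ?W = "rowlin p c i"
  have add: "rowlin p (\<lambda>k. a k + c k) i \<omega> = ?U \<omega> + ?W \<omega>" for \<omega>
    by (simp add: rowlin_def algebra_simps sum.distrib)
  have pol: "(\<lambda>\<omega>. ?U \<omega> * ?W \<omega>) = (\<lambda>\<omega>. ((rowlin p (\<lambda>k. a k + c k) i \<omega>)\<^sup>2 - (?U \<omega>)\<^sup>2 - (?W \<omega>)\<^sup>2) / 2)"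
    by (simp add: add power2_eq_square algebra_simps)
  show "integrable (gauss J) (\<lambda>\<omega>. ?U \<omega> * ?W \<omega>)" unfolding pol using sq(1) by simp
  have "expectation (\<lambda>\<omega>. ?U \<omega> * ?W \<omega>) = (dotp p (\<lambda>k. a k + c k) (\<lambda>k. a k + c k) - dotp p a a - dotp p c c) / 2"
    unfolding pol using sq by simp
  also have "\<dots> = dotp p a c"
    by (simp add: dotp_def sum_subtractf[symmetric] sum_divide_distrib) (simp add: algebra_simps)
  finally show "expectation (\<lambda>\<omega>. ?U \<omega> * ?W \<omega>) = dotp p a c" .
  have amgm: "(?U \<omega> * ?W \<omega>)\<^sup>2 \<le> (s * ?U \<omega> ^ 4 + ?W \<omega> ^ 4 / s) / 2" if "s > 0" for s \<omega>
  proof -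
    have "0 \<le> (s * (?U \<omega>)\<^sup>2 - (?W \<omega>)\<^sup>2)\<^sup>2 / s" using that by simp
    also have "\<dots> = s * ?U \<omega> ^ 4 - 2 * (?U \<omega> * ?W \<omega>)\<^sup>2 + ?W \<omega> ^ 4 / s"
      using that by (simp add: power2_eq_square power4_eq_xxxx field_simps)
    finally show ?thesis by simp
  qed
  have int: "integrable (gauss J) (\<lambda>\<omega>. (s * ?U \<omega> ^ 4 + ?W \<omega> ^ 4 / s) / 2)" for s
    using fo(1)[of a] fo(1)[of c] by simp
  show int2: "integrable (gauss J) (\<lambda>\<omega>. (?U \<omega> * ?W \<omega>)\<^sup>2)"
    by (rule Bochner_Integration.integrable_bound[OF int[of 1]])
       (use amgm[of 1] in \<open>auto intro!: AE_I2 order_trans[OF _ abs_ge_self]\<close>)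
  show "expectation (\<lambda>\<omega>. (?U \<omega> * ?W \<omega>)\<^sup>2) \<le> 3 * dotp p a a * dotp p c c"
  proof (cases "dotp p a a = 0 \<or> dotp p c c = 0")
    case True
    have "rowlin p b i \<omega> = 0" if "dotp p b b = 0" for b \<omega>
      using that by (simp add: dotp_self_eq_0 rowlin_def)
    then have "(\<lambda>\<omega>. (?U \<omega> * ?W \<omega>)\<^sup>2) = (\<lambda>\<omega>. 0)" using True by auto
    then show ?thesis using dotp_self_nonneg[of p a] dotp_self_nonneg[of p c] by simp
  next
    case False
    then have pos: "dotp p a a > 0" "dotp p c c > 0"
      using dotp_self_nonneg[of p a] dotp_self_nonneg[of p c] by auto
    \<comment> \<open>This weight balances the two fourth-moment terms: each becomes three times the
      product of the squared norms, as Cauchy-Schwarz would give.\<close>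
    define s where "s = dotp p c c / dotp p a a"
    have "expectation (\<lambda>\<omega>. (?U \<omega> * ?W \<omega>)\<^sup>2) \<le> expectation (\<lambda>\<omega>. (s * ?U \<omega> ^ 4 + ?W \<omega> ^ 4 / s) / 2)"
      using pos by (intro integral_mono int2 int amgm) (simp add: s_def)
    also have "\<dots> = (s * (3 * (dotp p a a)\<^sup>2) + 3 * (dotp p c c)\<^sup>2 / s) / 2"
      using fo by simp
    also have "\<dots> = 3 * dotp p a a * dotp p c c"
      using pos by (simp add: s_def power2_eq_square field_simps)
    finally show ?thesis .
  qed
qed

lemma indep_vars_rows:
  assumes J: "\<And>i. i \<in> I \<Longrightarrow> {i} \<times> {0..<Suc p} \<subseteq> J"
    and f: "\<And>i. i \<in> I \<Longrightarrow> f i \<in> borel_measurable (gauss ({i} \<times> {0..<Suc p}))"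
    and r: "\<And>i \<omega>. i \<in> I \<Longrightarrow> f i (restrict \<omega> ({i} \<times> {0..<Suc p})) = f i \<omega>"
  shows "prob_space.indep_vars (gauss J) (\<lambda>_. borel) f I"
proof -
  interpret prob_space "gauss J" by (rule prob_space_PiM_std_normal)
  have "indep_vars (\<lambda>_. borel) (\<lambda>i \<omega>. f i (restrict \<omega> ({i} \<times> {0..<Suc p}))) I"
    by (intro indep_vars_PiM_blocks std_normal_prob_space J f) (auto simp: disjoint_family_on_def)
  then show ?thesis by (subst indep_vars_cong[OF refl _ refl]) (auto simp: r)
qed

text \<open>The centred products of different rows are independent, so the second moment of their
  sum is the sum of variances. Each variance is at most the uncentred second moment, which yields
  the factor 3.\<close>

lemma rowlin_chebyshev:
  assumes I: "finite I" and t: "t > 0"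
  shows "measure (gauss (I \<times> {0..<Suc p}))
      {\<omega> \<in> space (gauss (I \<times> {0..<Suc p})).
        t \<le> \<bar>\<Sum>i\<in>I. rowlin p a i \<omega> * rowlin p c i \<omega> - dotp p a c\<bar>}
    \<le> real (card I) * (3 * dotp p a a * dotp p c c) / t\<^sup>2"
proof -
  let ?J = "I \<times> {0..<Suc p}"
  interpret prob_space "gauss ?J" by (rule prob_space_PiM_std_normal)
  define X where "X = (\<lambda>i \<omega>. rowlin p a i \<omega> * rowlin p c i \<omega> - dotp p a c)"
  have sub: "{i} \<times> {0..<p} \<subseteq> {i} \<times> {0..<Suc p}" for i :: nat by auto
  have sub': "{i} \<times> {0..<p} \<subseteq> ?J" if "i \<in> I" for i using that by auto
  have ind: "indep_vars (\<lambda>_. borel) X I"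
    unfolding X_def
    by (intro indep_vars_rows borel_measurable_diff borel_measurable_times rowlin_measurable sub)
       (auto simp: rowlin_restrict[OF sub])
  have sq: "integrable (gauss ?J) (\<lambda>\<omega>. (X i \<omega>)\<^sup>2)" "expectation (X i) = 0"
    "expectation (\<lambda>\<omega>. (X i \<omega>)\<^sup>2) \<le> 3 * dotp p a a * dotp p c c" if i: "i \<in> I" for i
  proof -
    note R = rowlin_product[OF sub'[OF i], of a c]
    show "expectation (X i) = 0" unfolding X_def using R(1,2) by (simp add: prob_space)
    have eq: "(\<lambda>\<omega>. (X i \<omega>)\<^sup>2) = (\<lambda>\<omega>. (rowlin p a i \<omega> * rowlin p c i \<omega>)\<^sup>2
        - 2 * dotp p a c * (rowlin p a i \<omega> * rowlin p c i \<omega>) + (dotp p a c)\<^sup>2)"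
      by (simp add: X_def power2_diff algebra_simps)
    show "integrable (gauss ?J) (\<lambda>\<omega>. (X i \<omega>)\<^sup>2)" unfolding eq using R(1,3) by simp
    have "expectation (\<lambda>\<omega>. (X i \<omega>)\<^sup>2) = expectation (\<lambda>\<omega>. (rowlin p a i \<omega> * rowlin p c i \<omega>)\<^sup>2) - (dotp p a c)\<^sup>2"
      unfolding eq using R(1,2,3) by (simp add: prob_space power2_eq_square)
    also have "\<dots> \<le> 3 * dotp p a a * dotp p c c"
      using R(4) zero_le_power2[of "dotp p a c"] by linarith
    finally show "expectation (\<lambda>\<omega>. (X i \<omega>)\<^sup>2) \<le> 3 * dotp p a a * dotp p c c" .
  qed
  note S = second_moment_indep_sum[OF I ind sq(1,2)]
  have "prob {\<omega> \<in> space (gauss ?J). t \<le> \<bar>\<Sum>i\<in>I. X i \<omega>\<bar>}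
      = prob {\<omega> \<in> space (gauss ?J). t\<^sup>2 \<le> (\<Sum>i\<in>I. X i \<omega>)\<^sup>2}"
    using t by (intro arg_cong[where f = prob] Collect_cong) (auto simp: abs_le_square_iff[symmetric])
  also have "\<dots> \<le> expectation (\<lambda>\<omega>. (\<Sum>i\<in>I. X i \<omega>)\<^sup>2) / t\<^sup>2"
    by (rule integral_Markov_inequality_measure[where A = "{}"]) (use S t in auto)
  also have "\<dots> \<le> real (card I) * (3 * dotp p a a * dotp p c c) / t\<^sup>2"
    using S sum_bounded_above[of I "\<lambda>i. expectation (\<lambda>\<omega>. (X i \<omega>)\<^sup>2)", OF sq(3)]
    by (intro divide_right_mono) auto
  finally show ?thesis by (simp add: X_def)
qed

section \<open>Central limit theorem for the leading term\<close>

definition normal_product :: "real measure" where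
  "normal_product = distr (std_normal_distribution \<Otimes>\<^sub>M std_normal_distribution) borel (\<lambda>(x, y). x * y)"

text \<open>The form and the noise read disjoint coordinates of row i and are therefore independent;
  after scaling both are standard normal. Thus the summands share the law
  \<open>normal_product\<close>, whatever p, a and i.\<close>

lemma rowlin_noise_product:
  assumes J: "{i} \<times> {0..<Suc p} \<subseteq> J" and a: "dotp p a a > 0"
  defines "X \<equiv> \<lambda>\<omega>. rowlin p a i \<omega> * \<omega> (i, p) / sqrt (dotp p a a)"
  shows "distr (gauss J) borel X = normal_product"
    "(LINT \<omega>|gauss J. X \<omega>) = 0"
    "integrable (gauss J) (\<lambda>\<omega>. (X \<omega>)\<^sup>2)"
    "(LINT \<omega>|gauss J. (X \<omega>)\<^sup>2) = 1"
proof -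
  interpret prob_space "gauss J" by (rule prob_space_PiM_std_normal)
  interpret N: prob_space std_normal_distribution by (rule std_normal_prob_space)
  let ?U = "\<lambda>\<omega>. rowlin p a i \<omega> / sqrt (dotp p a a)" and ?V = "\<lambda>\<omega>. \<omega> (i, p)"
  let ?A = "{i} \<times> {0..<p}" and ?B = "{(i, p)}"
  have sub: "?A \<subseteq> J" "(i, p) \<in> J" using J by auto
  have mU: "rowlin p a i \<in> borel_measurable (gauss J)" by (rule rowlin_measurable[OF sub(1)])
  have id: "distr std_normal_distribution borel (\<lambda>x. x) = std_normal_distribution"
    by (rule distr_id2) simp
  have U: "distr (gauss J) borel ?U = std_normal_distribution"
  proof -
    have "distr (gauss J) borel ?U = distr (distr (gauss J) borel (rowlin p a i)) borel (\<lambda>x. x / sqrt (dotp p a a))"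
      using mU by (subst distr_distr) (auto simp: comp_def)
    also have "\<dots> = std_normal_distribution"
      unfolding distr_rowlin[OF sub(1)] using a by (subst distr_distr) (auto simp: comp_def id)
    finally show ?thesis .
  qed
  have V: "distr (gauss J) borel ?V = std_normal_distribution"
    by (rule distr_gauss_component[OF sub(2)])
  have "indep_var borel ((\<lambda>\<omega>. rowlin p a i \<omega> / sqrt (dotp p a a)) \<circ> (\<lambda>\<omega>. restrict \<omega> ?A))
      borel ((\<lambda>\<omega>. \<omega> (i, p)) \<circ> (\<lambda>\<omega>. restrict \<omega> ?B))"
    by (rule indep_var_compose[OF indep_var_restrict[OF indep_vars_PiM_components[OF std_normal_prob_space], of ?A ?B]])
       (use sub in \<open>auto intro!: borel_measurable_divide rowlin_measurable borel_measurable_PiM_std_normal_component\<close>)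
  then have ind: "indep_var borel ?U borel ?V"
    by (simp add: comp_def rowlin_restrict)
  have X: "X = (\<lambda>\<omega>. ?U \<omega> * ?V \<omega>)" by (simp add: X_def)
  have mV: "?V \<in> borel_measurable (gauss J)" by (rule borel_measurable_PiM_std_normal_component[OF sub(2)])
  have mU': "?U \<in> borel_measurable (gauss J)" using mU by simp
  have "distr (gauss J) (borel \<Otimes>\<^sub>M borel) (\<lambda>\<omega>. (?U \<omega>, ?V \<omega>))
      = std_normal_distribution \<Otimes>\<^sub>M std_normal_distribution"
    using indep_var_distribution_eq[THEN iffD1, OF ind] U V by simp
  then have "normal_product = distr (distr (gauss J) (borel \<Otimes>\<^sub>M borel) (\<lambda>\<omega>. (?U \<omega>, ?V \<omega>))) borel (\<lambda>(x, y). x * y)"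
    by (simp add: normal_product_def)
  also have "\<dots> = distr (gauss J) borel X"
    unfolding X using mU' mV by (subst distr_distr) (auto simp: comp_def)
  finally show "distr (gauss J) borel X = normal_product" ..
  note U2 = scaled_normal_square[OF mU', of 1, unfolded U] scaled_normal_mean[OF mU', of 1, unfolded U]
  note V2 = scaled_normal_square[OF mV, of 1, unfolded V] scaled_normal_mean[OF mV, of 1, unfolded V]
  have U3: "integrable (gauss J) (\<lambda>\<omega>. (?U \<omega>)\<^sup>2)" "expectation (\<lambda>\<omega>. (?U \<omega>)\<^sup>2) = 1" "expectation ?U = 0"
    using U2 id by auto
  have V3: "integrable (gauss J) (\<lambda>\<omega>. (?V \<omega>)\<^sup>2)" "expectation (\<lambda>\<omega>. (?V \<omega>)\<^sup>2) = 1" "expectation ?V = 0"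
    using V2 id by auto
  have UV: "integrable (gauss J) ?U" "integrable (gauss J) ?V"
    by (rule square_integrable_imp_integrable[OF mU' U3(1)] square_integrable_imp_integrable[OF mV V3(1)])+
  show "expectation X = 0"
    unfolding X indep_var_lebesgue_integral[OF ind UV] U3(3) by simp
  have ind2: "indep_var borel (\<lambda>\<omega>. (?U \<omega>)\<^sup>2) borel (\<lambda>\<omega>. (?V \<omega>)\<^sup>2)"
    using indep_var_compose[OF ind, of "\<lambda>x. x\<^sup>2" borel "\<lambda>x. x\<^sup>2" borel] by (simp add: comp_def)
  show "integrable (gauss J) (\<lambda>\<omega>. (X \<omega>)\<^sup>2)"
    unfolding X power_mult_distrib by (rule indep_var_integrable[OF ind2 U3(1) V3(1)])
  show "expectation (\<lambda>\<omega>. (X \<omega>)\<^sup>2) = 1"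
    unfolding X power_mult_distrib using indep_var_lebesgue_integral[OF ind2 U3(1) V3(1)] U3(2) V3(2) by simp
qed

lemma indep_vars_rowlin_noise:
  assumes J: "\<And>i. i \<in> I \<Longrightarrow> {i} \<times> {0..<Suc p} \<subseteq> J"
  shows "prob_space.indep_vars (gauss J) (\<lambda>_. borel) (\<lambda>i \<omega>. rowlin p a i \<omega> * \<omega> (i, p) / s) I"
proof -
  have sub: "{i} \<times> {0..<p} \<subseteq> {i} \<times> {0..<Suc p}" for i :: nat by auto
  show ?thesis
    by (rule indep_vars_rows[OF J])
       (auto intro!: borel_measurable_divide borel_measurable_times rowlin_measurable
          borel_measurable_PiM_std_normal_component simp: rowlin_restrict[OF sub])
qed

text \<open>The law of the sum does not depend on \<open>p\<close> and \<open>a\<close>; it is compared with the infinite array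
  \<open>gauss (UNIV \<times> {0..<2})\<close>, to which the central limit theorem of the library applies.\<close>
lemma rowlin_noise_clt:
  obtains F where "\<And>z. (\<lambda>n. F n z) \<longlonglongrightarrow> Phi z"
    "\<And>n p a z. dotp p a a > 0 \<Longrightarrow> measure (sample_space n p)
      {\<omega> \<in> space (sample_space n p).
        (\<Sum>i<n. rowlin p a i \<omega> * \<omega> (i, p)) / sqrt (dotp p a a) / sqrt (real n) \<le> z} = F n z"
proof -
  \<comment> \<open>The reference array takes p = 1, one design column and one noise column, with
    infinitely many rows.\<close>
  let ?J = "UNIV \<times> {0..<Suc 1}"
  define Q where "Q = gauss ?J"
  interpret Q: prob_space Q unfolding Q_def by (rule prob_space_PiM_std_normal)
  define b where "b = (\<lambda>k::nat. 1::real)"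
  have b: "dotp 1 b b = 1" by (simp add: dotp_def b_def)
  then have b': "dotp 1 b b > 0" by simp
  define X where "X = (\<lambda>i \<omega>. rowlin 1 b i \<omega> * \<omega> (i, 1) / sqrt (dotp 1 b b))"
  have X: "distr Q borel (X i) = normal_product" "Q.expectation (X i) = 0"
      "integrable Q (\<lambda>\<omega>. (X i \<omega>)\<^sup>2)" "Q.expectation (\<lambda>\<omega>. (X i \<omega>)\<^sup>2) = 1" for i
    unfolding X_def Q_def by (rule rowlin_noise_product[of i 1 ?J b, OF _ b']; auto)+
  have ind: "Q.indep_vars (\<lambda>_. borel) X UNIV"
    unfolding X_def Q_def by (rule indep_vars_rowlin_noise) auto
  have rvX: "X i \<in> borel_measurable Q" for i using ind by (simp add: Q.indep_vars_def2)
  \<comment> \<open>The factor \<open>1\<^sup>2\<close> keeps the shape of the central limit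
    theorem, with variance 1.\<close>
  define F where "F = (\<lambda>n. cdf (distr Q borel (\<lambda>\<omega>. (\<Sum>i<n. X i \<omega>) / sqrt (real n * 1\<^sup>2))))"
  have "weak_conv_m (\<lambda>n. distr Q borel (\<lambda>\<omega>. (\<Sum>i<n. X i \<omega>) / sqrt (real n * 1\<^sup>2))) std_normal_distribution"
    by (rule Q.central_limit_theorem_zero_mean[OF ind]) (use X in auto)
  then have lim: "(\<lambda>n. F n z) \<longlonglongrightarrow> Phi z" for z
    using isCont_Phi by (simp add: weak_conv_m_def weak_conv_def F_def Phi_def)
  have "measure (sample_space n p) {\<omega> \<in> space (sample_space n p).
        (\<Sum>i<n. rowlin p a i \<omega> * \<omega> (i, p)) / sqrt (dotp p a a) / sqrt (real n) \<le> z} = F n z"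
    if a: "dotp p a a > 0" for n p a z
  proof -
    let ?S = "gauss ({0..<n} \<times> {0..<Suc p})"
    define Y where "Y = (\<lambda>i \<omega>. rowlin p a i \<omega> * \<omega> (i, p) / sqrt (dotp p a a))"
    interpret S: prob_space ?S by (rule prob_space_PiM_std_normal)
    have indY: "S.indep_vars (\<lambda>_. borel) Y {..<n}"
      unfolding Y_def by (rule indep_vars_rowlin_noise) auto
    have rvY: "Y i \<in> borel_measurable ?S" if "i < n" for i
      using indY that by (simp add: S.indep_vars_def2)
    have dY: "distr ?S borel (Y i) = normal_product" if "i < n" for i
      unfolding Y_def using that by (intro rowlin_noise_product(1)[OF _ a]) auto
    \<comment> \<open>The first n summands of the reference array have the same laws as those of the
      sample, and both are independent families, so the sums agree in law for each n
      exactly.\<close>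
    have eq: "distr ?S borel (\<lambda>\<omega>. \<Sum>i<n. Y i \<omega>) = distr Q borel (\<lambda>\<omega>. \<Sum>i<n. X i \<omega>)"
      by (rule distr_sum_indep_eq[OF S.prob_space_axioms Q.prob_space_axioms indY Q.indep_vars_subset[OF ind]])
         (auto simp: dY X)
    have "measure ?S {\<omega> \<in> space ?S. (\<Sum>i<n. Y i \<omega>) / sqrt (real n) \<le> z}
        = measure (distr ?S borel (\<lambda>\<omega>. \<Sum>i<n. Y i \<omega>)) {x. x / sqrt (real n) \<le> z}"
      using rvY by (subst measure_distr) (auto intro!: arg_cong[where f = S.prob])
    also have "\<dots> = F n z"
      unfolding eq F_def cdf_def using rvX
      by (subst (1 2) measure_distr) (auto intro!: arg_cong[where f = Q.prob])
    finally show ?thesis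
      by (simp add: sample_space_def Y_def sum_divide_distrib)
  qed
  with lim show ?thesis by (rule that)
qed

subsection \<open>The split-sample one-step estimator\<close>

text \<open>With S the Gram matrix of R, covariances of linear forms in a design row become dot
  products of their coefficients on the standard normals.\<close>

lemma dotp_mv_gram:
  assumes "\<And>j l. j < p \<Longrightarrow> l < p \<Longrightarrow> (\<Sum>k<p. R k j * R k l) = S j l"
  shows "dotp p (mv p R u) (mv p R v) = dotp p u (mv p S v)"
proof -
  have "dotp p (mv p R u) (mv p R v) = (\<Sum>k<p. \<Sum>j<p. \<Sum>l<p. u j * (R k j * R k l) * v l)"
    by (simp add: dotp_def mv_def sum_product mult_ac)
  also have "\<dots> = (\<Sum>j<p. \<Sum>k<p. \<Sum>l<p. u j * (R k j * R k l) * v l)" by (rule sum.swap)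
  also have "\<dots> = (\<Sum>j<p. \<Sum>l<p. \<Sum>k<p. u j * (R k j * R k l) * v l)"
    by (intro sum.cong refl sum.swap)
  also have "\<dots> = (\<Sum>j<p. \<Sum>l<p. u j * S j l * v l)"
    by (intro sum.cong refl) (simp add: assms[symmetric] sum_distrib_left sum_distrib_right)
  also have "\<dots> = dotp p u (mv p S v)"
    by (simp add: dotp_def mv_def sum_distrib_left mult.assoc)
  finally show ?thesis .
qed

text \<open>A linear form in a design row is rewritten over the i.i.d. normals with coefficients R
  v; the noise coordinate (i, p) does not enter.\<close>

lemma design_linear: "(\<Sum>j<p. design p R \<omega> i j * v j) = rowlin p (mv p R v) i \<omega>"
proof -
  have "(\<Sum>j<p. design p R \<omega> i j * v j) = (\<Sum>j<p. \<Sum>k<p. \<omega> (i, k) * (R k j * v j))"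
    by (simp add: design_def sum_distrib_right mult.assoc)
  also have "\<dots> = (\<Sum>k<p. \<Sum>j<p. \<omega> (i, k) * (R k j * v j))" by (rule sum.swap)
  finally show ?thesis by (simp add: rowlin_def mv_def sum_distrib_left)
qed

lemma design_bilinear:
  "(\<Sum>j<p. T j * (\<Sum>i\<in>I. design p R \<omega> i j * f i)) = (\<Sum>i\<in>I. rowlin p (mv p R T) i \<omega> * f i)"
proof -
  have "(\<Sum>j<p. T j * (\<Sum>i\<in>I. design p R \<omega> i j * f i))
      = (\<Sum>j<p. \<Sum>i\<in>I. design p R \<omega> i j * T j * f i)"
    by (simp add: sum_distrib_left mult_ac)
  also have "\<dots> = (\<Sum>i\<in>I. \<Sum>j<p. design p R \<omega> i j * T j * f i)" by (rule sum.swap)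
  finally show ?thesis by (simp add: design_linear[symmetric] sum_distrib_right)
qed

text \<open>The residual at e is the noise minus the design applied to \<delta>. Centring the
  resulting products costs \<open>?c\<close>, whose index-0 part is \<delta> 0 because (S T) 0 = 1;
  this cancels the error of the initial estimator and leaves the bias over the other
  indices.\<close>

lemma onestep_decomposition:
  fixes e b :: "nat \<Rightarrow> real"
  assumes root: "\<And>j l. j < p \<Longrightarrow> l < p \<Longrightarrow> (\<Sum>k<p. R k j * R k l) = S j l"
    and sym: "\<And>i j. i < p \<Longrightarrow> j < p \<Longrightarrow> S i j = S j i"
    and p: "0 < p" and T: "mv p S T 0 = 1" and I: "2 * card I = n" "0 < n"
  defines "\<delta> \<equiv> \<lambda>j. e j - b j"
  shows "onestep n p T (design p R \<omega>) (response p R b \<omega>) I e - b 0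
      - 2 * (\<Sum>i\<in>I. rowlin p (mv p R T) i \<omega> * \<omega> (i, p)) / real n
    = - (\<Sum>j\<in>{1..<p}. mv p S T j * \<delta> j)
      - 2 * (\<Sum>i\<in>I. rowlin p (mv p R T) i \<omega> * rowlin p (mv p R \<delta>) i \<omega>
          - dotp p (mv p R T) (mv p R \<delta>)) / real n"
proof -
  let ?U = "\<lambda>i. rowlin p (mv p R T) i \<omega>" and ?W = "\<lambda>i. rowlin p (mv p R \<delta>) i \<omega>"
  let ?c = "dotp p (mv p R T) (mv p R \<delta>)"
  have res: "response p R b \<omega> i - (\<Sum>k<p. design p R \<omega> i k * e k) = \<omega> (i, p) - ?W i" for i
    by (simp add: response_def noise_def design_linear[symmetric] \<delta>_def algebra_simps sum_subtractf)
  have c: "?c = \<delta> 0 + (\<Sum>j\<in>{1..<p}. mv p S T j * \<delta> j)"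
  proof -
    have "?c = dotp p T (mv p S \<delta>)" by (rule dotp_mv_gram) (rule root)
    also have "\<dots> = dotp p (mv p S T) \<delta>" by (rule dotp_mv_sym) (rule sym)
    finally show ?thesis unfolding dotp_def[of p "mv p S T"] sum_lessThan_split_0[OF p] by (simp add: T)
  qed
  \<comment> \<open>As I holds half of the rows, the factor 2 / n turns the sum of the centring
    constants into exactly \<open>?c\<close>.\<close>
  have "(\<Sum>i\<in>I. ?c) = real n / 2 * ?c" using I(1) by auto
  then have s: "2 * (\<Sum>i\<in>I. ?U i * ?W i - ?c) / real n = 2 * (\<Sum>i\<in>I. ?U i * ?W i) / real n - ?c"
    using I by (simp add: sum_subtractf field_simps)
  have "onestep n p T (design p R \<omega>) (response p R b \<omega>) I e
      = e 0 + 2 * (\<Sum>i\<in>I. ?U i * (\<omega> (i, p) - ?W i)) / real n"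
    by (simp only: onestep_def res design_bilinear)
  also have "\<dots> = e 0 + 2 * (\<Sum>i\<in>I. ?U i * \<omega> (i, p)) / real n - 2 * (\<Sum>i\<in>I. ?U i * ?W i) / real n"
    by (simp add: right_diff_distrib sum_subtractf diff_divide_distrib)
  finally show ?thesis
    using s c unfolding \<delta>_def by linarith
qed

lemma dotp_borel_measurable:
  assumes "\<And>k. k < p \<Longrightarrow> (\<lambda>\<omega>. u \<omega> k) \<in> borel_measurable M" "\<And>k. k < p \<Longrightarrow> (\<lambda>\<omega>. v \<omega> k) \<in> borel_measurable M"
  shows "(\<lambda>\<omega>. dotp p (u \<omega>) (v \<omega>)) \<in> borel_measurable M"
  unfolding dotp_def using assms by (intro borel_measurable_sum borel_measurable_times) auto

lemma mv_borel_measurable: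
  assumes "\<And>k. k < p \<Longrightarrow> (\<lambda>\<omega>. u \<omega> k) \<in> borel_measurable M"
  shows "(\<lambda>\<omega>. mv p A (u \<omega>) k) \<in> borel_measurable M"
  unfolding mv_def using assms by (intro borel_measurable_sum borel_measurable_times) auto

lemma rowlin_borel_measurable:
  assumes "{i} \<times> {0..<p} \<subseteq> J" "\<And>k. k < p \<Longrightarrow> (\<lambda>\<omega>. c \<omega> k) \<in> borel_measurable (gauss J)"
  shows "(\<lambda>\<omega>. rowlin p (c \<omega>) i \<omega>) \<in> borel_measurable (gauss J)"
  unfolding rowlin_def using assms
  by (intro borel_measurable_sum borel_measurable_times borel_measurable_PiM_std_normal_component) auto

text \<open>Given the coordinates in \<open>J\<close>, the vector \<open>c \<omega>\<close> is constant, so that Chebyshev's inequality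
  applies to each section.\<close>
lemma sample_split_deviation:
  fixes a :: "nat \<Rightarrow> real" and c :: "(nat \<times> nat \<Rightarrow> real) \<Rightarrow> nat \<Rightarrow> real"
  assumes fin: "finite J" "finite I" and disj: "J \<inter> I \<times> {0..<Suc p} = {}" and t: "t > 0"
    and dep: "\<And>\<omega> \<omega>'. (\<And>k. k \<in> J \<Longrightarrow> \<omega> k = \<omega>' k) \<Longrightarrow> c \<omega> = c \<omega>'"
    and s: "0 \<le> s"
    and c: "\<And>k. (\<lambda>\<omega>. c \<omega> k) \<in> borel_measurable (gauss (J \<union> I \<times> {0..<Suc p}))"
  defines "D \<equiv> {\<omega> \<in> space (gauss (J \<union> I \<times> {0..<Suc p})). dotp p (c \<omega>) (c \<omega>) \<le> s \<and>
      t \<le> \<bar>\<Sum>i\<in>I. rowlin p a i \<omega> * rowlin p (c \<omega>) i \<omega> - dotp p a (c \<omega>)\<bar>}"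
  shows "D \<in> sets (gauss (J \<union> I \<times> {0..<Suc p}))"
    "measure (gauss (J \<union> I \<times> {0..<Suc p})) D \<le> real (card I) * (3 * dotp p a a * s) / t\<^sup>2"
proof -
  let ?K = "I \<times> {0..<Suc p}"
  have mD: "(\<lambda>\<omega>. dotp p (c \<omega>) (c \<omega>)) \<in> borel_measurable (gauss (J \<union> ?K))"
    by (intro dotp_borel_measurable c)
  have mE: "(\<lambda>\<omega>. \<Sum>i\<in>I. rowlin p a i \<omega> * rowlin p (c \<omega>) i \<omega> - dotp p a (c \<omega>)) \<in> borel_measurable (gauss (J \<union> ?K))"
    by (intro borel_measurable_sum borel_measurable_diff borel_measurable_times rowlin_borel_measurable
        dotp_borel_measurable c rowlin_measurable) auto
  show D: "D \<in> sets (gauss (J \<union> ?K))"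
    unfolding D_def using mD mE by measurable
  show "measure (gauss (J \<union> ?K)) D \<le> real (card I) * (3 * dotp p a a * s) / t\<^sup>2"
    proof (rule PiM_prob_le_sections[OF std_normal_product_prob_space disj fin(1) _ D])
      show "finite ?K" using fin by simp
      fix y assume y: "y \<in> space (gauss J)"
      let ?E = "{x \<in> space (gauss ?K). merge J ?K (y, x) \<in> D}"
      \<comment> \<open>The vector c reads only coordinates in J, where the merged point agrees with
        y; the values of y outside J are irrelevant.\<close>
      have cy: "c (merge J ?K (y, x)) = c y" for x
        by (rule dep) (use disj in auto)
      have row: "rowlin p v i (merge J ?K (y, x)) = rowlin p v i x" if "i \<in> I" for v i x
        unfolding rowlin_def using that disj by (intro sum.cong) (auto simp: merge_def)
      show "measure (gauss ?K) ?E \<le> real (card I) * (3 * dotp p a a * s) / t\<^sup>2"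
      proof (cases "dotp p (c y) (c y) \<le> s")
        case True
        have "?E \<subseteq> {x \<in> space (gauss ?K). t \<le> \<bar>\<Sum>i\<in>I. rowlin p a i x * rowlin p (c y) i x - dotp p a (c y)\<bar>}"
          unfolding D_def by (auto simp: cy row)
        moreover have "(\<lambda>x. \<Sum>i\<in>I. rowlin p a i x * rowlin p (c y) i x - dotp p a (c y)) \<in> borel_measurable (gauss ?K)"
          by (intro borel_measurable_sum borel_measurable_diff borel_measurable_times rowlin_measurable) auto
        ultimately have "measure (gauss ?K) ?E \<le> measure (gauss ?K)
            {x \<in> space (gauss ?K). t \<le> \<bar>\<Sum>i\<in>I. rowlin p a i x * rowlin p (c y) i x - dotp p a (c y)\<bar>}"
          using prob_space_PiM_std_normal[of ?K]
          by (intro finite_measure.finite_measure_mono prob_space.finite_measure) auto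
        also have "\<dots> \<le> real (card I) * (3 * dotp p a a * dotp p (c y) (c y)) / t\<^sup>2"
          by (rule rowlin_chebyshev[OF fin(2) t])
        also have "\<dots> \<le> real (card I) * (3 * dotp p a a * s) / t\<^sup>2"
          using True dotp_self_nonneg[of p a] by (intro divide_right_mono mult_left_mono) auto
        finally show ?thesis .
      next
        \<comment> \<open>The norm constraint is part of D, so these sections are empty and the
          bound holds for every y.\<close>
        case False
        then have E: "?E = {}" unfolding D_def by (auto simp: cy)
        show ?thesis unfolding E using s dotp_self_nonneg[of p a] by simp
      qed
    qed
qed

section \<open>Dependence on rows, measurability and the error on one half\<close>

lemma design_cong:
  "(\<And>k. k < Suc p \<Longrightarrow> \<omega> (i, k) = \<omega>' (i, k)) \<Longrightarrow> design p R \<omega> i j = design p R \<omega>' i j"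
  unfolding design_def by (intro sum.cong) auto

lemma response_cong:
  "(\<And>k. k < Suc p \<Longrightarrow> \<omega> (i, k) = \<omega>' (i, k)) \<Longrightarrow> response p R b \<omega> i = response p R b \<omega>' i"
  unfolding response_def noise_def by (simp add: design_cong[of p \<omega> i \<omega>'])

lemma design_borel_measurable:
  "i < n \<Longrightarrow> (\<lambda>\<omega>. design p R \<omega> i j) \<in> borel_measurable (sample_space n p)"
  unfolding design_def sample_space_def
  by (intro borel_measurable_sum borel_measurable_times borel_measurable_PiM_std_normal_component) auto

lemma response_borel_measurable:
  "i < n \<Longrightarrow> (\<lambda>\<omega>. response p R b \<omega> i) \<in> borel_measurable (sample_space n p)"
  unfolding response_def noise_def
  by (intro borel_measurable_sum borel_measurable_add borel_measurable_times design_borel_measurable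
      borel_measurable_const)
     (auto simp: sample_space_def intro!: borel_measurable_PiM_std_normal_component)

lemma onestep_borel_measurable:
  assumes I: "I \<subseteq> {0..<n}" and p: "0 < p"
    and e: "\<And>j. j < p \<Longrightarrow> (\<lambda>\<omega>. e (design p R \<omega>) (response p R b \<omega>) j) \<in> borel_measurable (sample_space n p)"
  shows "(\<lambda>\<omega>. onestep n p T (design p R \<omega>) (response p R b \<omega>) I
      (e (design p R \<omega>) (response p R b \<omega>))) \<in> borel_measurable (sample_space n p)"
  unfolding onestep_def using I p
  by (intro borel_measurable_add borel_measurable_divide borel_measurable_times borel_measurable_sum
      borel_measurable_diff borel_measurable_const design_borel_measurable response_borel_measurable e) auto

lemma prob_space_sample_space: "prob_space (sample_space n p)"
  unfolding sample_space_def by (rule prob_space_PiM_std_normal)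

lemma rowlin_noise_borel_measurable:
  "I \<subseteq> {0..<n} \<Longrightarrow> (\<lambda>\<omega>. \<Sum>i\<in>I. rowlin p a i \<omega> * \<omega> (i, p)) \<in> borel_measurable (sample_space n p)"
  unfolding sample_space_def
  by (intro borel_measurable_sum borel_measurable_times rowlin_measurable
      borel_measurable_PiM_std_normal_component) auto

text \<open>The bias is controlled by the \<open>\<ell>\<^sub>1\<close>-error and the centred sum by
  the prediction error of the estimator from the complementary rows. Each may use up \<eta> / 2; the
  exceptional events are a large error of either kind and a large centred sum despite a small
  prediction error.\<close>

lemma onestep_error_bound:
  fixes b :: "nat \<Rightarrow> real" and e :: "(nat \<Rightarrow> nat \<Rightarrow> real) \<Rightarrow> (nat \<Rightarrow> real) \<Rightarrow> nat \<Rightarrow> real"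
  assumes root: "\<And>j l. j < p \<Longrightarrow> l < p \<Longrightarrow> (\<Sum>k<p. R k j * R k l) = S j l"
    and sym: "\<And>i j. i < p \<Longrightarrow> j < p \<Longrightarrow> S i j = S j i"
    and p: "0 < p" and T0: "mv p S T 0 = 1"
    and Ti: "\<And>j. j \<in> {1..<p} \<Longrightarrow> \<bar>mv p S T j\<bar> \<le> l * \<tau>"
    and I: "I \<subseteq> {0..<n}" "2 * card I = n" "0 < n"
    and dep: "\<And>X X' Y Y' j. (\<And>i. i \<in> {0..<n} - I \<Longrightarrow> (\<forall>j<p. X i j = X' i j) \<and> Y i = Y' i) \<Longrightarrow> j < p
      \<Longrightarrow> e X Y j = e X' Y' j"
    and meas: "\<And>j. j < p \<Longrightarrow> (\<lambda>\<omega>. e (design p R \<omega>) (response p R b \<omega>) j) \<in> borel_measurable (sample_space n p)"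
    and pos: "0 < \<eta>" "0 \<le> \<alpha>" "0 \<le> \<tau>" "0 \<le> l" "\<tau> * \<kappa> \<le> \<eta> / 2"
  defines "M \<equiv> sample_space n p"
    and "\<delta> \<equiv> \<lambda>\<omega> j. e (design p R \<omega>) (response p R b \<omega>) j - b j"
    and "err \<equiv> \<lambda>\<omega>. onestep n p T (design p R \<omega>) (response p R b \<omega>) I (e (design p R \<omega>) (response p R b \<omega>))
      - b 0 - 2 * (\<Sum>i\<in>I. rowlin p (mv p R T) i \<omega> * \<omega> (i, p)) / real n"
  shows "measure M {\<omega> \<in> space M. \<eta> < sqrt (real n) * \<bar>err \<omega>\<bar>}
    \<le> measure M {\<omega> \<in> space M. \<kappa> < \<bar>sqrt (real n) * l * (\<Sum>j<p. \<bar>\<delta> \<omega> j\<bar>)\<bar>}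
      + measure M {\<omega> \<in> space M. \<alpha> < \<bar>sqrt (qform p S (\<delta> \<omega>))\<bar>} + 24 * qform p S T * \<alpha>\<^sup>2 / \<eta>\<^sup>2"
proof -
  interpret M: prob_space M unfolding M_def by (rule prob_space_sample_space)
  let ?J = "({0..<n} - I) \<times> {0..<Suc p}"
  have JI: "?J \<union> I \<times> {0..<Suc p} = {0..<n} \<times> {0..<Suc p}" using I(1) by auto
  have fI: "finite I" using I(1) finite_subset by blast
  define c where "c = (\<lambda>\<omega>. mv p R (\<delta> \<omega>))"
  define a where "a = mv p R T"
  have gram: "dotp p (mv p R u) (mv p R u) = qform p S u" for u
    unfolding qform_eq_dotp by (rule dotp_mv_gram) (rule root)
  have m\<delta>: "(\<lambda>\<omega>. \<delta> \<omega> j) \<in> borel_measurable M" if "j < p" for j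
    unfolding \<delta>_def M_def by (intro borel_measurable_diff meas that) simp
  have mc: "(\<lambda>\<omega>. c \<omega> k) \<in> borel_measurable M" for k
    unfolding c_def by (intro mv_borel_measurable m\<delta>)
  \<comment> \<open>Row i of design and response is a function of the coordinates (i, k) with k at
    most p, so an estimator that reads rows outside I is a function of the coordinates in
    \<open>?J\<close>.\<close>
  have depc: "c \<omega> = c \<omega>'" if "\<And>k. k \<in> ?J \<Longrightarrow> \<omega> k = \<omega>' k" for \<omega> \<omega>'
  proof -
    have "\<delta> \<omega> j = \<delta> \<omega>' j" if "j < p" for j
    proof -
      have "e (design p R \<omega>) (response p R b \<omega>) j = e (design p R \<omega>') (response p R b \<omega>') j"
      proof (rule dep[OF _ that])
        fix i assume "i \<in> {0..<n} - I"
        then have "\<omega> (i, k) = \<omega>' (i, k)" if "k < Suc p" for k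
          using that \<open>\<And>k. k \<in> ?J \<Longrightarrow> \<omega> k = \<omega>' k\<close>[of "(i, k)"] by simp
        then show "(\<forall>j<p. design p R \<omega> i j = design p R \<omega>' i j) \<and> response p R b \<omega> i = response p R b \<omega>' i"
          using design_cong[of p \<omega> i \<omega>'] response_cong[of p \<omega> i \<omega>'] by blast
      qed
      then show ?thesis by (simp add: \<delta>_def)
    qed
    then show ?thesis by (auto simp: c_def mv_def)
  qed
  \<comment> \<open>Chosen so that 2 t / n, multiplied by sqrt n, is \<eta> / 2.\<close>
  define t where "t = sqrt (real n) * \<eta> / 4"
  have t: "t > 0" using pos(1) I(3) by (simp add: t_def)
  \<comment> \<open>Large prediction errors are left to \<open>?B\<close>, so the variance bound on
    D is deterministic.\<close>
  define D where "D = {\<omega> \<in> space M. dotp p (c \<omega>) (c \<omega>) \<le> \<alpha>\<^sup>2 \<and>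
      t \<le> \<bar>\<Sum>i\<in>I. rowlin p a i \<omega> * rowlin p (c \<omega>) i \<omega> - dotp p a (c \<omega>)\<bar>}"
  have M': "M = gauss (?J \<union> I \<times> {0..<Suc p})" by (simp add: JI M_def sample_space_def)
  have D: "D \<in> M.events" "M.prob D \<le> real (card I) * (3 * dotp p a a * \<alpha>\<^sup>2) / t\<^sup>2"
    unfolding D_def M' by (rule sample_split_deviation; use fI t mc M' in \<open>auto intro: depc\<close>)+
  \<comment> \<open>The constant is 24 = 3 * (1/2) * 16: half of the rows, and 16 from the square of
    the 4 in t.\<close>
  have "real (card I) * (3 * dotp p a a * \<alpha>\<^sup>2) / t\<^sup>2 = 24 * qform p S T * \<alpha>\<^sup>2 / \<eta>\<^sup>2"
  proof -
    have "real (card I) = real n / 2" using I(2) by auto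
    then show ?thesis using I(3) pos(1)
      by (simp add: t_def power_mult_distrib power_divide a_def gram field_simps)
  qed
  with D(2) have PD: "M.prob D \<le> 24 * qform p S T * \<alpha>\<^sup>2 / \<eta>\<^sup>2" by simp
  let ?A = "{\<omega> \<in> space M. \<kappa> < \<bar>sqrt (real n) * l * (\<Sum>j<p. \<bar>\<delta> \<omega> j\<bar>)\<bar>}"
  let ?B = "{\<omega> \<in> space M. \<alpha> < \<bar>sqrt (qform p S (\<delta> \<omega>))\<bar>}"
  have "(\<lambda>\<omega>. qform p S (\<delta> \<omega>)) \<in> borel_measurable M"
    unfolding gram[symmetric] by (intro dotp_borel_measurable mv_borel_measurable m\<delta>)
  then have B: "?B \<in> M.events" by measurable
  have "(\<lambda>\<omega>. sqrt (real n) * l * (\<Sum>j<p. \<bar>\<delta> \<omega> j\<bar>)) \<in> borel_measurable M"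
    by (intro borel_measurable_times borel_measurable_sum borel_measurable_abs m\<delta>) auto
  then have A: "?A \<in> M.events" by measurable
  have sub: "{\<omega> \<in> space M. \<eta> < sqrt (real n) * \<bar>err \<omega>\<bar>} \<subseteq> ?A \<union> ?B \<union> D"
  proof (rule ccontr)
    assume "\<not> ?thesis"
    then obtain \<omega> where \<omega>: "\<omega> \<in> space M" "\<eta> < sqrt (real n) * \<bar>err \<omega>\<bar>" "\<omega> \<notin> ?A" "\<omega> \<notin> ?B" "\<omega> \<notin> D"
      by blast
    define s1 where "s1 = (\<Sum>j\<in>{1..<p}. mv p S T j * \<delta> \<omega> j)"
    define s2 where "s2 = (\<Sum>i\<in>I. rowlin p a i \<omega> * rowlin p (c \<omega>) i \<omega> - dotp p a (c \<omega>))"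
    have err: "err \<omega> = - s1 - 2 * s2 / real n"
      unfolding err_def s1_def s2_def a_def c_def \<delta>_def
      by (rule onestep_decomposition[OF root sym p T0 I(2,3)])
    have "\<bar>sqrt (qform p S (\<delta> \<omega>))\<bar> \<le> \<alpha>" using \<omega> by auto
    then have "sqrt (dotp p (c \<omega>) (c \<omega>)) \<le> \<alpha>" by (simp add: c_def gram)
    then have "dotp p (c \<omega>) (c \<omega>) \<le> \<alpha>\<^sup>2" by (rule sqrt_le_D)
    then have "\<bar>s2\<bar> < t" using \<omega> by (auto simp: D_def s2_def)
    then have "\<bar>2 * s2 / real n\<bar> \<le> 2 * t / real n"
      by (simp add: abs_mult divide_right_mono)
    then have "sqrt (real n) * \<bar>2 * s2 / real n\<bar> \<le> sqrt (real n) * (2 * t / real n)"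
      by (intro mult_left_mono) auto
    also have "\<dots> = 2 * t * (sqrt (real n) / real n)" by simp
    also have "sqrt (real n) / real n = inverse (sqrt (real n))" by (rule sqrt_divide_self_eq) simp
    also have "2 * t * inverse (sqrt (real n)) = \<eta> / 2" using I(3) by (simp add: t_def)
    finally have e2: "sqrt (real n) * \<bar>2 * s2 / real n\<bar> \<le> \<eta> / 2" .
    \<comment> \<open>Hoelder's inequality: the entries of S T other than the first are at most l
      \<tau>, and \<delta> enters through its \<open>\<ell>\<^sub>1\<close>-norm.\<close>
    have "\<bar>s1\<bar> \<le> (\<Sum>j\<in>{1..<p}. \<bar>mv p S T j * \<delta> \<omega> j\<bar>)" unfolding s1_def by (rule sum_abs)
    also have "\<dots> \<le> (\<Sum>j\<in>{1..<p}. l * \<tau> * \<bar>\<delta> \<omega> j\<bar>)"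
      by (intro sum_mono) (auto simp: abs_mult intro!: mult_right_mono Ti)
    also have "\<dots> \<le> (\<Sum>j<p. l * \<tau> * \<bar>\<delta> \<omega> j\<bar>)"
      using pos by (intro sum_mono2) auto
    finally have "\<bar>s1\<bar> \<le> l * \<tau> * (\<Sum>j<p. \<bar>\<delta> \<omega> j\<bar>)" by (simp add: sum_distrib_left)
    then have "sqrt (real n) * \<bar>s1\<bar> \<le> sqrt (real n) * (l * \<tau> * (\<Sum>j<p. \<bar>\<delta> \<omega> j\<bar>))"
      by (intro mult_left_mono) auto
    also have "\<dots> = \<tau> * (sqrt (real n) * l * (\<Sum>j<p. \<bar>\<delta> \<omega> j\<bar>))" by (simp add: mult_ac)
    also have "\<dots> \<le> \<tau> * \<kappa>" using \<omega> pos by (intro mult_left_mono) auto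
    finally have e1: "sqrt (real n) * \<bar>s1\<bar> \<le> \<eta> / 2" using pos by linarith
    have "\<bar>err \<omega>\<bar> \<le> \<bar>s1\<bar> + \<bar>2 * s2 / real n\<bar>" unfolding err by linarith
    then have "sqrt (real n) * \<bar>err \<omega>\<bar> \<le> sqrt (real n) * (\<bar>s1\<bar> + \<bar>2 * s2 / real n\<bar>)"
      by (intro mult_left_mono) auto
    also have "\<dots> \<le> \<eta>" unfolding distrib_left using e1 e2 by linarith
    finally show False using \<omega>(2) by simp
  qed
  have "M.prob {\<omega> \<in> space M. \<eta> < sqrt (real n) * \<bar>err \<omega>\<bar>} \<le> M.prob (?A \<union> ?B \<union> D)"
    using A B D(1) sub by (intro M.finite_measure_mono) auto
  also have "\<dots> \<le> M.prob (?A \<union> ?B) + M.prob D"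
    using A B D(1) by (intro measure_Un_le) auto
  also have "M.prob (?A \<union> ?B) \<le> M.prob ?A + M.prob ?B"
    using A B by (intro measure_Un_le) auto
  finally show ?thesis using PD by linarith
qed

section \<open>Averaging the two halves and passing to the limit law\<close>

lemma bhat_borel_measurable:
  assumes p: "0 < p"
    and eI: "\<And>j. j < p \<Longrightarrow> (\<lambda>\<omega>. eI (design p R \<omega>) (response p R b \<omega>) j) \<in> borel_measurable (sample_space n p)"
    and eII: "\<And>j. j < p \<Longrightarrow> (\<lambda>\<omega>. eII (design p R \<omega>) (response p R b \<omega>) j) \<in> borel_measurable (sample_space n p)"
  shows "bhat n p R T eI eII b \<in> borel_measurable (sample_space n p)"
  unfolding bhat_def[abs_def] Let_def
  by (intro borel_measurable_divide borel_measurable_add onestep_borel_measurable p eI eII) auto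

text \<open>An average exceeds a threshold in absolute value only if one of the two half errors
  does. Each half is paired with the estimator from the other half, and 48 is twice the constant of
  one half.\<close>

lemma bhat_error_bound:
  fixes b :: "nat \<Rightarrow> real" and eI eII :: "(nat \<Rightarrow> nat \<Rightarrow> real) \<Rightarrow> (nat \<Rightarrow> real) \<Rightarrow> nat \<Rightarrow> real"
  assumes root: "\<And>j l. j < p \<Longrightarrow> l < p \<Longrightarrow> (\<Sum>k<p. R k j * R k l) = S j l"
    and sym: "\<And>i j. i < p \<Longrightarrow> j < p \<Longrightarrow> S i j = S j i"
    and p: "0 < p" and T0: "mv p S T 0 = 1"
    and Ti: "\<And>j. j \<in> {1..<p} \<Longrightarrow> \<bar>mv p S T j\<bar> \<le> l * \<tau>"
    and n: "even n" "0 < n"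
    and depI: "\<forall>X X' Y Y'. (\<forall>i<n div 2. (\<forall>j<p. X i j = X' i j) \<and> Y i = Y' i)
                 \<longrightarrow> (\<forall>j<p. eI X Y j = eI X' Y' j)"
    and depII: "\<forall>X X' Y Y'. (\<forall>i. n div 2 \<le> i \<and> i < n \<longrightarrow> (\<forall>j<p. X i j = X' i j) \<and> Y i = Y' i)
                 \<longrightarrow> (\<forall>j<p. eII X Y j = eII X' Y' j)"
    and measI: "\<And>j. j < p \<Longrightarrow> (\<lambda>\<omega>. eI (design p R \<omega>) (response p R b \<omega>) j) \<in> borel_measurable (sample_space n p)"
    and measII: "\<And>j. j < p \<Longrightarrow> (\<lambda>\<omega>. eII (design p R \<omega>) (response p R b \<omega>) j) \<in> borel_measurable (sample_space n p)"
    and pos: "0 < \<eta>" "0 \<le> \<alpha>" "0 \<le> \<tau>" "0 \<le> l" "\<tau> * \<kappa> \<le> \<eta> / 2"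
  defines "M \<equiv> sample_space n p"
    and "d \<equiv> \<lambda>e \<omega> j. e (design p R \<omega>) (response p R b \<omega>) j - b j"
  shows "measure M {\<omega> \<in> space M. \<eta> * (1 / sqrt (real n)) < \<bar>bhat n p R T eI eII b \<omega> - b 0
        - (\<Sum>j<p. T j * (\<Sum>i<n. design p R \<omega> i j * noise p \<omega> i)) / real n\<bar>}
    \<le> measure M {\<omega> \<in> space M. \<kappa> < \<bar>sqrt (real n) * l * (\<Sum>j<p. \<bar>d eI \<omega> j\<bar>)\<bar>}
      + measure M {\<omega> \<in> space M. \<kappa> < \<bar>sqrt (real n) * l * (\<Sum>j<p. \<bar>d eII \<omega> j\<bar>)\<bar>}
      + measure M {\<omega> \<in> space M. \<alpha> < \<bar>sqrt (qform p S (d eI \<omega>))\<bar>}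
      + measure M {\<omega> \<in> space M. \<alpha> < \<bar>sqrt (qform p S (d eII \<omega>))\<bar>}
      + 48 * qform p S T * \<alpha>\<^sup>2 / \<eta>\<^sup>2"
proof -
  interpret M: prob_space M unfolding M_def by (rule prob_space_sample_space)
  let ?I = "{0..<n div 2}" and ?II = "{n div 2..<n}"
  define f where "f = (\<lambda>\<omega> i. rowlin p (mv p R T) i \<omega> * \<omega> (i, p))"
  define err where "err = (\<lambda>I e \<omega>. onestep n p T (design p R \<omega>) (response p R b \<omega>) I
    (e (design p R \<omega>) (response p R b \<omega>)) - b 0 - 2 * (\<Sum>i\<in>I. f \<omega> i) / real n)"
  have card: "2 * card ?I = n" "2 * card ?II = n" using n(1) by auto
  have sub: "?I \<subseteq> {0..<n}" "?II \<subseteq> {0..<n}" by auto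
  have mf: "(\<lambda>\<omega>. \<Sum>i\<in>I. f \<omega> i) \<in> borel_measurable M" if "I \<subseteq> {0..<n}" for I
    unfolding f_def M_def by (rule rowlin_noise_borel_measurable[OF that])
  have mI: "err ?I eII \<in> borel_measurable M"
    unfolding err_def M_def
    by (intro borel_measurable_diff borel_measurable_divide borel_measurable_times borel_measurable_const
        onestep_borel_measurable[OF sub(1) p measII] mf[OF sub(1), unfolded M_def])
  have mII: "err ?II eI \<in> borel_measurable M"
    unfolding err_def M_def
    by (intro borel_measurable_diff borel_measurable_divide borel_measurable_times borel_measurable_const
        onestep_borel_measurable[OF sub(2) p measI] mf[OF sub(2), unfolded M_def])
  let ?A = "{\<omega> \<in> space M. \<eta> < sqrt (real n) * \<bar>err ?I eII \<omega>\<bar>}"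
  let ?B = "{\<omega> \<in> space M. \<eta> < sqrt (real n) * \<bar>err ?II eI \<omega>\<bar>}"
  have A: "M.prob ?A \<le> M.prob {\<omega> \<in> space M. \<kappa> < \<bar>sqrt (real n) * l * (\<Sum>j<p. \<bar>d eII \<omega> j\<bar>)\<bar>}
      + M.prob {\<omega> \<in> space M. \<alpha> < \<bar>sqrt (qform p S (d eII \<omega>))\<bar>} + 24 * qform p S T * \<alpha>\<^sup>2 / \<eta>\<^sup>2"
    unfolding M_def err_def d_def f_def
  proof (rule onestep_error_bound[OF root sym p T0 Ti sub(1) card(1) n(2) _ measII pos])
    fix X X' :: "nat \<Rightarrow> nat \<Rightarrow> real" and Y Y' :: "nat \<Rightarrow> real" and j
    assume *: "\<And>i. i \<in> {0..<n} - ?I \<Longrightarrow> (\<forall>j<p. X i j = X' i j) \<and> Y i = Y' i" "j < p"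
    have "\<forall>i. n div 2 \<le> i \<and> i < n \<longrightarrow> (\<forall>j<p. X i j = X' i j) \<and> Y i = Y' i"
      by (intro allI impI *(1)) auto
    then show "eII X Y j = eII X' Y' j" using depII *(2) by blast
  qed
  have B: "M.prob ?B \<le> M.prob {\<omega> \<in> space M. \<kappa> < \<bar>sqrt (real n) * l * (\<Sum>j<p. \<bar>d eI \<omega> j\<bar>)\<bar>}
      + M.prob {\<omega> \<in> space M. \<alpha> < \<bar>sqrt (qform p S (d eI \<omega>))\<bar>} + 24 * qform p S T * \<alpha>\<^sup>2 / \<eta>\<^sup>2"
    unfolding M_def err_def d_def f_def
  proof (rule onestep_error_bound[OF root sym p T0 Ti sub(2) card(2) n(2) _ measI pos])
    fix X X' :: "nat \<Rightarrow> nat \<Rightarrow> real" and Y Y' :: "nat \<Rightarrow> real" and j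
    assume *: "\<And>i. i \<in> {0..<n} - ?II \<Longrightarrow> (\<forall>j<p. X i j = X' i j) \<and> Y i = Y' i" "j < p"
    have "\<forall>i<n div 2. (\<forall>j<p. X i j = X' i j) \<and> Y i = Y' i"
      by (intro allI impI *(1)) auto
    then show "eI X Y j = eI X' Y' j" using depI *(2) by blast
  qed
  \<comment> \<open>Each half carries 2 / n times its own noise sum, so averaging yields 1 / n times
    the sum over all rows.\<close>
  have dec: "bhat n p R T eI eII b \<omega> - b 0 - (\<Sum>j<p. T j * (\<Sum>i<n. design p R \<omega> i j * noise p \<omega> i)) / real n
      = (err ?I eII \<omega> + err ?II eI \<omega>) / 2" for \<omega>
  proof -
    have "(\<Sum>j<p. T j * (\<Sum>i<n. design p R \<omega> i j * noise p \<omega> i)) = (\<Sum>i<n. f \<omega> i)"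
      by (simp add: design_bilinear f_def noise_def)
    also have "\<dots> = (\<Sum>i\<in>?I. f \<omega> i) + (\<Sum>i\<in>?II. f \<omega> i)"
      by (simp add: lessThan_atLeast0 sum.atLeastLessThan_concat)
    finally show ?thesis
      by (simp add: bhat_def Let_def err_def add_divide_distrib diff_divide_distrib)
  qed
  have "{\<omega> \<in> space M. \<eta> * (1 / sqrt (real n)) < \<bar>(err ?I eII \<omega> + err ?II eI \<omega>) / 2\<bar>} \<subseteq> ?A \<union> ?B"
  proof (rule ccontr)
    assume "\<not> ?thesis"
    then obtain \<omega> where \<omega>: "\<eta> * (1 / sqrt (real n)) < \<bar>(err ?I eII \<omega> + err ?II eI \<omega>) / 2\<bar>"
      "sqrt (real n) * \<bar>err ?I eII \<omega>\<bar> \<le> \<eta>" "sqrt (real n) * \<bar>err ?II eI \<omega>\<bar> \<le> \<eta>"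
      by (fastforce simp: not_less)
    have "\<bar>err ?I eII \<omega>\<bar> \<le> \<eta> * (1 / sqrt (real n))" "\<bar>err ?II eI \<omega>\<bar> \<le> \<eta> * (1 / sqrt (real n))"
      using \<omega>(2,3) n(2) by (simp_all add: field_simps)
    moreover have "\<bar>(err ?I eII \<omega> + err ?II eI \<omega>) / 2\<bar> \<le> (\<bar>err ?I eII \<omega>\<bar> + \<bar>err ?II eI \<omega>\<bar>) / 2"
      by (simp add: abs_triangle_ineq divide_right_mono)
    ultimately show False using \<omega>(1) by argo
  qed
  moreover have AB: "?A \<in> M.events" "?B \<in> M.events" using mI mII by measurable
  ultimately have "M.prob {\<omega> \<in> space M. \<eta> * (1 / sqrt (real n)) < \<bar>(err ?I eII \<omega> + err ?II eI \<omega>) / 2\<bar>}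
      \<le> M.prob (?A \<union> ?B)" by (intro M.finite_measure_mono) auto
  also have "\<dots> \<le> M.prob ?A + M.prob ?B" using AB by (intro measure_Un_le) auto
  finally show ?thesis unfolding dec using A B by linarith
qed

text \<open>A non-asymptotic Slutsky argument: off A the events at level z are sandwiched between
  events of W at shifted levels. The effect of r enters as two inequalities on thresholds, so that
  the sign of z does not matter.\<close>

lemma (in prob_space) slutsky_bounds:
  fixes G W :: "'a \<Rightarrow> real"
  assumes G [measurable]: "random_variable borel G" and W [measurable]: "random_variable borel W"
    and A: "A \<in> events" and r: "0 < r" and d: "(z + d) / r \<le> z + 2 * d" "z - 2 * d \<le> (z - d) / r"
    and close: "\<And>\<omega>. \<omega> \<in> space M \<Longrightarrow> \<omega> \<notin> A \<Longrightarrow> \<bar>G \<omega> - r * W \<omega>\<bar> \<le> d"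
  shows "prob {\<omega> \<in> space M. G \<omega> \<le> z} \<le> prob {\<omega> \<in> space M. W \<omega> \<le> z + 2 * d} + prob A"
    "prob {\<omega> \<in> space M. W \<omega> \<le> z - 2 * d} \<le> prob {\<omega> \<in> space M. G \<omega> \<le> z} + prob A"
proof -
  have "W \<omega> \<le> z + 2 * d" if "\<omega> \<in> space M" "\<omega> \<notin> A" "G \<omega> \<le> z" for \<omega>
  proof -
    have "r * W \<omega> \<le> z + d" using close[OF that(1,2)] that(3) by linarith
    then have "W \<omega> \<le> (z + d) / r" using r by (simp add: field_simps)
    with d(1) show ?thesis by linarith
  qed
  then have "{\<omega> \<in> space M. G \<omega> \<le> z} \<subseteq> {\<omega> \<in> space M. W \<omega> \<le> z + 2 * d} \<union> A" by blast
  then have "prob {\<omega> \<in> space M. G \<omega> \<le> z} \<le> prob ({\<omega> \<in> space M. W \<omega> \<le> z + 2 * d} \<union> A)"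
    using A by (intro finite_measure_mono) auto
  also have "\<dots> \<le> prob {\<omega> \<in> space M. W \<omega> \<le> z + 2 * d} + prob A"
    using A by (intro measure_Un_le) auto
  finally show "prob {\<omega> \<in> space M. G \<omega> \<le> z} \<le> prob {\<omega> \<in> space M. W \<omega> \<le> z + 2 * d} + prob A" .
  have "G \<omega> \<le> z" if "\<omega> \<in> space M" "\<omega> \<notin> A" "W \<omega> \<le> z - 2 * d" for \<omega>
  proof -
    have "W \<omega> \<le> (z - d) / r" using d(2) that(3) by linarith
    then have "r * W \<omega> \<le> z - d" using r by (simp add: field_simps)
    with close[OF that(1,2)] show ?thesis by linarith
  qed
  then have "{\<omega> \<in> space M. W \<omega> \<le> z - 2 * d} \<subseteq> {\<omega> \<in> space M. G \<omega> \<le> z} \<union> A" by blast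
  then have "prob {\<omega> \<in> space M. W \<omega> \<le> z - 2 * d} \<le> prob ({\<omega> \<in> space M. G \<omega> \<le> z} \<union> A)"
    using A by (intro finite_measure_mono) auto
  also have "\<dots> \<le> prob {\<omega> \<in> space M. G \<omega> \<le> z} + prob A"
    using A by (intro measure_Un_le) auto
  finally show "prob {\<omega> \<in> space M. W \<omega> \<le> z - 2 * d} \<le> prob {\<omega> \<in> space M. G \<omega> \<le> z} + prob A" .
qed

lemma eventually_evens: "eventually (\<lambda>n. even n \<and> 0 < n) evens"
  unfolding evens_def eventually_filtermap using eventually_gt_at_top[of "0::nat"] by eventually_elim simp

lemma evens_le_sequentially: "evens \<le> sequentially"
proof -
  have "filterlim (\<lambda>m::nat. 2 * m) sequentially sequentially"
    by (intro filterlim_subseq strict_monoI) simp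
  then show ?thesis by (simp add: evens_def filterlim_def)
qed

text \<open>Probabilities are bounded by 1, so the real supremum over any such family is an upper
  bound.\<close>

lemma measure_le_SUP:
  assumes "prob_space M" "b \<in> B"
  shows "measure M (A b) \<le> (SUP b\<in>B. measure M (A b))"
proof -
  interpret prob_space M by fact
  show ?thesis using assms(2) by (intro cSUP_upper bdd_aboveI[of _ 1]) auto
qed

text \<open>W is the leading term divided by its own standard deviation, whereas G is normalised by
  \<open>T 0\<close>; r is the ratio of the two scalings. Off E the remainder is at most d / 2 after
  scaling by sqrt n, and the lower bound on \<open>T 0\<close> at most doubles it.\<close>

lemma standardized_bhat_bounds:
  fixes d z :: real and b :: "nat \<Rightarrow> real" and eI eII :: "(nat \<Rightarrow> nat \<Rightarrow> real) \<Rightarrow> (nat \<Rightarrow> real) \<Rightarrow> nat \<Rightarrow> real"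
  assumes root: "\<And>j l. j < p \<Longrightarrow> l < p \<Longrightarrow> (\<Sum>k<p. R k j * R k l) = S j l"
    and p: "0 < p" and n: "0 < n"
    and eI: "\<And>j. j < p \<Longrightarrow> (\<lambda>\<omega>. eI (design p R \<omega>) (response p R b \<omega>) j) \<in> borel_measurable (sample_space n p)"
    and eII: "\<And>j. j < p \<Longrightarrow> (\<lambda>\<omega>. eII (design p R \<omega>) (response p R b \<omega>) j) \<in> borel_measurable (sample_space n p)"
    and T: "1 / 4 \<le> T 0" "0 < qform p S T"
  defines "M \<equiv> sample_space n p" and "r \<equiv> sqrt (qform p S T / T 0)"
    and "W \<equiv> \<lambda>\<omega>. (\<Sum>i<n. rowlin p (mv p R T) i \<omega> * \<omega> (i, p)) / sqrt (qform p S T) / sqrt (real n)"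
    and "G \<equiv> \<lambda>\<omega>. sqrt (real n) * (bhat n p R T eI eII b \<omega> - b 0) / sqrt (T 0)"
    and "E \<equiv> {\<omega> \<in> space (sample_space n p). d / 2 * (1 / sqrt (real n)) < \<bar>bhat n p R T eI eII b \<omega> - b 0
        - (\<Sum>j<p. T j * (\<Sum>i<n. design p R \<omega> i j * noise p \<omega> i)) / real n\<bar>}"
  assumes d: "0 < d" "(z + d) / r \<le> z + 2 * d" "z - 2 * d \<le> (z - d) / r"
  shows "measure M {\<omega> \<in> space M. G \<omega> \<le> z} \<le> measure M {\<omega> \<in> space M. W \<omega> \<le> z + 2 * d} + measure M E"
    "measure M {\<omega> \<in> space M. W \<omega> \<le> z - 2 * d} \<le> measure M {\<omega> \<in> space M. G \<omega> \<le> z} + measure M E"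
proof -
  interpret M: prob_space M unfolding M_def by (rule prob_space_sample_space)
  define f where "f = (\<lambda>\<omega>. \<Sum>i<n. rowlin p (mv p R T) i \<omega> * \<omega> (i, p))"
  define err where "err = (\<lambda>\<omega>. bhat n p R T eI eII b \<omega> - b 0 - f \<omega> / real n)"
  have mf: "f \<in> borel_measurable M"
    unfolding f_def M_def by (rule rowlin_noise_borel_measurable) auto
  have mb: "bhat n p R T eI eII b \<in> borel_measurable M"
    unfolding M_def by (rule bhat_borel_measurable[OF p eI eII])
  have mG: "G \<in> borel_measurable M" unfolding G_def using mb by measurable
  have mW: "W \<in> borel_measurable M" using mf unfolding W_def f_def by simp
  have E: "E = {\<omega> \<in> space M. d / 2 * (1 / sqrt (real n)) < \<bar>err \<omega>\<bar>}"
    unfolding E_def err_def M_def f_def by (simp add: design_bilinear noise_def)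
  have EM: "E \<in> M.events" unfolding E err_def using mb mf by measurable
  have r: "0 < r" using T by (simp add: r_def)
  have "\<bar>G \<omega> - r * W \<omega>\<bar> \<le> d" if "\<omega> \<in> space M" "\<omega> \<notin> E" for \<omega>
  proof -
    have s: "1 / 2 \<le> sqrt (T 0)" using T(1) by (intro real_le_rsqrt) (simp add: power2_eq_square)
    have "r * W \<omega> = f \<omega> / (sqrt (real n) * sqrt (T 0))"
      using T by (simp add: r_def W_def f_def real_sqrt_divide)
    also have "\<dots> = sqrt (real n) * (f \<omega> / real n) / sqrt (T 0)"
    proof -
      have "sqrt (real n) * (f \<omega> / real n) = f \<omega> * (sqrt (real n) / real n)" by simp
      also have "sqrt (real n) / real n = inverse (sqrt (real n))" by (rule sqrt_divide_self_eq) simp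
      also have "f \<omega> * inverse (sqrt (real n)) = f \<omega> / sqrt (real n)" by (simp only: divide_inverse)
      finally show ?thesis by (simp only: divide_divide_eq_left)
    qed
    finally have "G \<omega> - r * W \<omega> = sqrt (real n) * err \<omega> / sqrt (T 0)"
      by (simp add: G_def err_def diff_divide_distrib right_diff_distrib)
    then have "\<bar>G \<omega> - r * W \<omega>\<bar> = sqrt (real n) * \<bar>err \<omega>\<bar> / sqrt (T 0)"
      using T(1) by (simp add: abs_mult)
    also have "\<dots> \<le> (d / 2) / (1 / 2)"
    proof (rule frac_le)
      have "\<bar>err \<omega>\<bar> \<le> d / 2 * (1 / sqrt (real n))" using that by (auto simp: E)
      then show "sqrt (real n) * \<bar>err \<omega>\<bar> \<le> d / 2" using n by (simp add: field_simps)
    qed (use d s in auto)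
    finally show ?thesis by simp
  qed
  from M.slutsky_bounds[OF mG mW EM r d(2,3) this]
  show "M.prob {\<omega> \<in> space M. G \<omega> \<le> z} \<le> M.prob {\<omega> \<in> space M. W \<omega> \<le> z + 2 * d} + M.prob E"
    "M.prob {\<omega> \<in> space M. W \<omega> \<le> z - 2 * d} \<le> M.prob {\<omega> \<in> space M. G \<omega> \<le> z} + M.prob E"
    by auto
qed

section \<open>Uniform expansion and asymptotic normality\<close>

theorem theorem2p1:
  fixes p :: "nat \<Rightarrow> nat"
    and Sig R :: "nat \<Rightarrow> nat \<Rightarrow> nat \<Rightarrow> real"
    and B :: "nat \<Rightarrow> (nat \<Rightarrow> real) set"
    and gs :: "nat \<Rightarrow> nat \<Rightarrow> real"
    and lam :: "nat \<Rightarrow> real"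
    and bI bII :: "nat \<Rightarrow> (nat \<Rightarrow> nat \<Rightarrow> real) \<Rightarrow> (nat \<Rightarrow> real) \<Rightarrow> nat \<Rightarrow> real"
  defines "M \<equiv> \<lambda>n. sample_space n (p n)"
    and "Xd \<equiv> \<lambda>n \<omega>. design (p n) (R n) \<omega>"
    and "Yd \<equiv> \<lambda>n b \<omega>. response (p n) (R n) b \<omega>"
    and "Th \<equiv> \<lambda>n. Theta1 (p n) (Sig n) (gs n)"
  assumes p_pos: "\<forall>n. 0 < p n"
    and Sig_sym: "\<forall>n i j. i < p n \<longrightarrow> j < p n \<longrightarrow> Sig n i j = Sig n j i"
    and Sig_diag: "\<forall>n i. i < p n \<longrightarrow> Sig n i i = 1"
    and Sig_nonsing: "\<forall>n. nonsingular (p n) (Sig n)"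
    and Sig_eig: "(\<lambda>n. 1 / min_eigenvalue (p n) (Sig n)) \<in> O[evens](\<lambda>_. 1)"
    and R_root: "\<forall>n j l. j < p n \<longrightarrow> l < p n \<longrightarrow> (\<Sum>k<p n. R n k j * R n k l) = Sig n j l"
    and B_ne: "\<forall>n. B n \<noteq> {}"
    and elig1: "\<forall>n. 0 < lam n \<and> (\<forall>i\<in>{1..<p n}.
                  \<bar>\<Sum>j\<in>{1..<p n}. Sig n i j * (gs n j - gamma0 (p n) (Sig n) j)\<bar> \<le> lam n)"
    and elig2: "((\<lambda>n. lam n * (\<Sum>j\<in>{1..<p n}. \<bar>gs n j\<bar>)) \<longlongrightarrow> 0) evens"
    and depI: "\<forall>n X X' Y Y'. (\<forall>i<n div 2. (\<forall>j<p n. X i j = X' i j) \<and> Y i = Y' i)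
                 \<longrightarrow> (\<forall>j<p n. bI n X Y j = bI n X' Y' j)"
    and depII: "\<forall>n X X' Y Y'. (\<forall>i. n div 2 \<le> i \<and> i < n \<longrightarrow> (\<forall>j<p n. X i j = X' i j) \<and> Y i = Y' i)
                 \<longrightarrow> (\<forall>j<p n. bII n X Y j = bII n X' Y' j)"
    and measI: "\<forall>n. \<forall>b\<in>B n. \<forall>j<p n. (\<lambda>\<omega>. bI n (Xd n \<omega>) (Yd n b \<omega>) j) \<in> borel_measurable (M n)"
    and measII: "\<forall>n. \<forall>b\<in>B n. \<forall>j<p n. (\<lambda>\<omega>. bII n (Xd n \<omega>) (Yd n b \<omega>) j) \<in> borel_measurable (M n)"
    and consI: "unif_oP evens B M
       (\<lambda>n b \<omega>. sqrt (qform (p n) (Sig n) (\<lambda>j. bI n (Xd n \<omega>) (Yd n b \<omega>) j - b j))) (\<lambda>_. 1)"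
    and consII: "unif_oP evens B M
       (\<lambda>n b \<omega>. sqrt (qform (p n) (Sig n) (\<lambda>j. bII n (Xd n \<omega>) (Yd n b \<omega>) j - b j))) (\<lambda>_. 1)"
    and l1I: "unif_oP evens B M
       (\<lambda>n b \<omega>. sqrt (real n) * lam n * (\<Sum>j<p n. \<bar>bI n (Xd n \<omega>) (Yd n b \<omega>) j - b j\<bar>)) (\<lambda>_. 1)"
    and l1II: "unif_oP evens B M
       (\<lambda>n b \<omega>. sqrt (real n) * lam n * (\<Sum>j<p n. \<bar>bII n (Xd n \<omega>) (Yd n b \<omega>) j - b j\<bar>)) (\<lambda>_. 1)"
  shows "unif_oP evens B M
           (\<lambda>n b \<omega>. bhat n (p n) (R n) (Th n) (bI n) (bII n) b \<omega> - b 0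
              - (\<Sum>j<p n. Th n j * (\<Sum>i<n. Xd n \<omega> i j * noise (p n) \<omega> i)) / real n)
           (\<lambda>n. 1 / sqrt (real n))
       \<and> (\<forall>z. ((\<lambda>n. SUP b\<in>B n. measure (M n)
                 {\<omega>\<in>space (M n). sqrt (real n) * (bhat n (p n) (R n) (Th n) (bI n) (bII n) b \<omega> - b 0) / sqrt (Th n 0) \<le> z})
               \<longlongrightarrow> Phi z) evens)"
proof -
  \<comment> \<open>The root R makes the form at v the squared Euclidean norm of R v.\<close>
  have psd: "0 \<le> qform (p n) (Sig n) v" for n v
  proof -
    have "dotp (p n) (mv (p n) (R n) v) (mv (p n) (R n) v) = qform (p n) (Sig n) v"
      unfolding qform_eq_dotp by (rule dotp_mv_gram) (use R_root in blast)
    then show ?thesis by (metis dotp_self_nonneg)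
  qed
  have sym: "Sig n i j = Sig n j i" if "i < p n" "j < p n" for n i j using Sig_sym that by blast
  have root: "(\<Sum>k<p n. R n k j * R n k l) = Sig n j l" if "j < p n" "l < p n" for n j l
    using R_root that by blast
  have p: "0 < p n" for n using p_pos by blast
  have PM: "prob_space (M n)" for n unfolding M_def by (rule prob_space_sample_space)
  define q where "q = (\<lambda>n. qform (p n) (Sig n) (Th n))"
  define d where "d = (\<lambda>n. lam n * (\<Sum>j\<in>{1..<p n}. \<bar>gs n j\<bar>))"
  have d0: "0 \<le> d n" for n
    unfolding d_def using elig1 by (intro mult_nonneg_nonneg sum_nonneg) (auto intro: less_imp_le)
  have minpos: "0 < min_eigenvalue (p n) (Sig n)" for n
    by (rule min_eigenvalue_pos[OF _ psd p]) (use sym Sig_nonsing in auto)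
  obtain c where c: "0 < c" "eventually (\<lambda>n. 1 / min_eigenvalue (p n) (Sig n) \<le> c) evens"
  proof -
    from landau_o.bigE[OF Sig_eig] obtain c where "0 < c"
      "eventually (\<lambda>n. norm (1 / min_eigenvalue (p n) (Sig n)) \<le> c * norm (1::real)) evens" by blast
    moreover from this(2) have "eventually (\<lambda>n. 1 / min_eigenvalue (p n) (Sig n) \<le> c) evens"
      by eventually_elim (simp add: minpos abs_of_pos)
    ultimately show ?thesis by (intro that)
  qed
  \<comment> \<open>The smallest eigenvalue is eventually at least 1 / c = 2 / K. Once d n < 1 / K,
    the reciprocal of \<open>Th n 0\<close> is at least 1 / K.\<close>
  define K where "K = 2 * c"
  have K: "0 < K" using c(1) by (simp add: K_def)
  have small: "eventually (\<lambda>n. d n < e) evens" if "0 < e" for e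
    using order_tendstoD(2)[OF elig2 that] by (simp add: d_def)
  have smallK: "eventually (\<lambda>n. d n < 1 / K) evens" using K by (intro small) simp
  \<comment> \<open>\<open>Th n\<close> is the same for all b, so these bounds for large even n are
    uniform over the model class.\<close>
  have Th: "eventually (\<lambda>n. mv (p n) (Sig n) (Th n) 0 = 1
      \<and> (\<forall>j\<in>{1..<p n}. \<bar>mv (p n) (Sig n) (Th n) j\<bar> \<le> lam n * Th n 0)
      \<and> 1 / 4 \<le> Th n 0 \<and> Th n 0 \<le> K \<and> 1 \<le> q n \<and> q n \<le> 2 * K \<and> \<bar>q n / Th n 0 - 1\<bar> \<le> d n * K) evens"
    using c(2) smallK
  proof (eventually_elim)
    case (elim n)
    let ?m = "min_eigenvalue (p n) (Sig n)"
    have m: "1 / c \<le> ?m" using elim(1) c(1) minpos[of n] by (simp add: field_simps)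
    have dn: "d n < 1 / K" using elim K by simp
    have half: "1 / c = 2 * (1 / K)" by (simp add: K_def)
    have dm: "d n < ?m" using dn m half K by (smt (verit) divide_pos_pos)
    have TB: "Th n 0 > 0" "1 / Th n 0 \<ge> ?m - d n" "mv (p n) (Sig n) (Th n) 0 = 1"
      "\<And>i. i \<in> {1..<p n} \<Longrightarrow> \<bar>mv (p n) (Sig n) (Th n) i\<bar> \<le> lam n * Th n 0"
      "\<bar>q n / Th n 0 - 1\<bar> \<le> d n * Th n 0" "1 \<le> q n"
      unfolding Th_def q_def d_def
      by (rule Theta1_bounds[where l = "lam n"];
          use sym psd p Sig_nonsing Sig_diag elig1 dm[unfolded d_def] in \<open>auto\<close>)+
    have "1 / K \<le> 1 / Th n 0" using TB(2) m half dn by linarith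
    then have TK: "Th n 0 \<le> K" using TB(1) K by (simp add: field_simps)
    have "d n * Th n 0 \<le> d n * K" using TK d0 by (rule mult_left_mono)
    moreover have "d n * K \<le> 1" using dn K by (simp add: field_simps)
    ultimately have q1: "\<bar>q n / Th n 0 - 1\<bar> \<le> d n * K" "\<bar>q n / Th n 0 - 1\<bar> \<le> 1" using TB(5) by auto
    then have "q n / Th n 0 \<le> 2" by linarith
    \<comment> \<open>Together with 1 \<le> q n this gives \<open>Th n 0\<close> \<ge> 1/2, from
      which the stated bound 1/4 follows.\<close>
    then have q2: "q n \<le> 2 * Th n 0" using TB(1) by (simp add: field_simps)
    then show ?case using TB q1 TK by auto
  qed
  let ?err = "\<lambda>n b \<omega>. bhat n (p n) (R n) (Th n) (bI n) (bII n) b \<omega> - b 0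
              - (\<Sum>j<p n. Th n j * (\<Sum>i<n. Xd n \<omega> i j * noise (p n) \<omega> i)) / real n"
  have part1: "unif_oP evens B M ?err (\<lambda>n. 1 / sqrt (real n))"
    unfolding unif_oP_def
  proof (intro allI impI)
    fix \<eta> :: real assume \<eta>: "0 < \<eta>"
    let ?s = "\<lambda>n. SUP b\<in>B n. measure (M n) {\<omega> \<in> space (M n). \<eta> * (1 / sqrt (real n)) < \<bar>?err n b \<omega>\<bar>}"
    \<comment> \<open>A member of the nonempty class \<open>B n\<close> is used, since a real
      supremum over an empty set carries no information.\<close>
    have s0: "0 \<le> ?s n" for n
    proof -
      obtain b where "b \<in> B n" using B_ne by blast
      from measure_le_SUP[OF PM[of n] this] show ?thesis by (meson measure_nonneg order_trans)
    qed
    show "(?s \<longlongrightarrow> 0) evens"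
    proof (rule order_tendstoI)
      fix a :: real assume "a < 0"
      then show "eventually (\<lambda>n. a < ?s n) evens" using s0 by (intro always_eventually) (auto intro: less_le_trans)
    next
      fix a :: real assume a: "0 < a"
      \<comment> \<open>\<kappa> keeps the bias below \<eta> / 2 for \<open>Th n 0\<close> up to K.
        With \<alpha>, the variance bound 48 q \<alpha>^2 / \<eta>^2 is at most 96 a / 200, below a
        / 2, for q up to 2 K. The four suprema share a / 4, for a total below a.\<close>
      define \<kappa> where "\<kappa> = \<eta> / (2 * K)"
      define \<alpha> where "\<alpha> = sqrt (a * \<eta>\<^sup>2 / (200 * K))"
      have \<kappa>: "0 < \<kappa>" "K * \<kappa> \<le> \<eta> / 2" using \<eta> K by (auto simp: \<kappa>_def)
      have \<alpha>: "0 < \<alpha>" "\<alpha>\<^sup>2 = a * \<eta>\<^sup>2 / (200 * K)" using \<eta> K a by (auto simp: \<alpha>_def)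
      let ?L = "\<lambda>e n. SUP b\<in>B n. measure (M n) {\<omega> \<in> space (M n).
          \<kappa> < \<bar>sqrt (real n) * lam n * (\<Sum>j<p n. \<bar>e n (Xd n \<omega>) (Yd n b \<omega>) j - b j\<bar>)\<bar>}"
      let ?Q = "\<lambda>e n. SUP b\<in>B n. measure (M n) {\<omega> \<in> space (M n).
          \<alpha> < \<bar>sqrt (qform (p n) (Sig n) (\<lambda>j. e n (Xd n \<omega>) (Yd n b \<omega>) j - b j))\<bar>}"
      have lims: "(?L bI \<longlongrightarrow> 0) evens" "(?L bII \<longlongrightarrow> 0) evens" "(?Q bI \<longlongrightarrow> 0) evens" "(?Q bII \<longlongrightarrow> 0) evens"
        using l1I l1II consI consII \<kappa>(1) \<alpha>(1) unfolding unif_oP_def by auto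
      have "((\<lambda>n. ?L bI n + ?L bII n + ?Q bI n + ?Q bII n) \<longlongrightarrow> 0 + 0 + 0 + 0) evens"
        by (intro tendsto_add lims)
      then have "eventually (\<lambda>n. ?L bI n + ?L bII n + ?Q bI n + ?Q bII n < a / 4) evens"
        using a by (intro order_tendstoD(2)) auto
      then show "eventually (\<lambda>n. ?s n < a) evens"
        using Th eventually_evens
      proof eventually_elim
        case (elim n)
        have "?s n \<le> ?L bI n + ?L bII n + ?Q bI n + ?Q bII n + a / 2"
        proof (rule cSUP_least)
          show "B n \<noteq> {}" using B_ne by blast
          fix b assume b: "b \<in> B n"
          have "measure (M n) {\<omega> \<in> space (M n). \<eta> * (1 / sqrt (real n)) < \<bar>?err n b \<omega>\<bar>}
            \<le> measure (M n) {\<omega> \<in> space (M n). \<kappa> < \<bar>sqrt (real n) * lam n * (\<Sum>j<p n. \<bar>bI n (Xd n \<omega>) (Yd n b \<omega>) j - b j\<bar>)\<bar>}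
            + measure (M n) {\<omega> \<in> space (M n). \<kappa> < \<bar>sqrt (real n) * lam n * (\<Sum>j<p n. \<bar>bII n (Xd n \<omega>) (Yd n b \<omega>) j - b j\<bar>)\<bar>}
            + measure (M n) {\<omega> \<in> space (M n). \<alpha> < \<bar>sqrt (qform (p n) (Sig n) (\<lambda>j. bI n (Xd n \<omega>) (Yd n b \<omega>) j - b j))\<bar>}
            + measure (M n) {\<omega> \<in> space (M n). \<alpha> < \<bar>sqrt (qform (p n) (Sig n) (\<lambda>j. bII n (Xd n \<omega>) (Yd n b \<omega>) j - b j))\<bar>}
            + 48 * q n * \<alpha>\<^sup>2 / \<eta>\<^sup>2"
            unfolding M_def Xd_def Yd_def q_def
          proof (rule bhat_error_bound[where \<tau> = "Th n 0"])
            have "Th n 0 * \<kappa> \<le> K * \<kappa>" using elim \<kappa>(1) by (intro mult_right_mono) auto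
            then show "Th n 0 * \<kappa> \<le> \<eta> / 2" using \<kappa>(2) by linarith
            show "0 \<le> Th n 0" using elim by auto
            show "0 \<le> lam n" using elig1 less_imp_le by blast
            show "\<forall>X X' Y Y'. (\<forall>i<n div 2. (\<forall>j<p n. X i j = X' i j) \<and> Y i = Y' i)
                 \<longrightarrow> (\<forall>j<p n. bI n X Y j = bI n X' Y' j)" using depI by blast
            show "\<forall>X X' Y Y'. (\<forall>i. n div 2 \<le> i \<and> i < n \<longrightarrow> (\<forall>j<p n. X i j = X' i j) \<and> Y i = Y' i)
                 \<longrightarrow> (\<forall>j<p n. bII n X Y j = bII n X' Y' j)" using depII by blast
          qed (use elim \<eta> \<alpha>(1) p sym root b measI measII in \<open>auto simp: M_def Xd_def Yd_def\<close>)
          also have "48 * q n * \<alpha>\<^sup>2 / \<eta>\<^sup>2 \<le> 48 * (2 * K) * \<alpha>\<^sup>2 / \<eta>\<^sup>2"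
            using elim by (intro divide_right_mono mult_right_mono mult_left_mono) auto
          also have "\<dots> \<le> a / 2" using \<eta> K a by (simp add: \<alpha>(2) field_simps)
          finally show "measure (M n) {\<omega> \<in> space (M n). \<eta> * (1 / sqrt (real n)) < \<bar>?err n b \<omega>\<bar>}
            \<le> ?L bI n + ?L bII n + ?Q bI n + ?Q bII n + a / 2"
            using measure_le_SUP[OF PM[of n] b, where A = "\<lambda>b. {\<omega> \<in> space (M n). \<kappa> < \<bar>sqrt (real n) * lam n * (\<Sum>j<p n. \<bar>bI n (Xd n \<omega>) (Yd n b \<omega>) j - b j\<bar>)\<bar>}"]
              measure_le_SUP[OF PM[of n] b, where A = "\<lambda>b. {\<omega> \<in> space (M n). \<kappa> < \<bar>sqrt (real n) * lam n * (\<Sum>j<p n. \<bar>bII n (Xd n \<omega>) (Yd n b \<omega>) j - b j\<bar>)\<bar>}"]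
              measure_le_SUP[OF PM[of n] b, where A = "\<lambda>b. {\<omega> \<in> space (M n). \<alpha> < \<bar>sqrt (qform (p n) (Sig n) (\<lambda>j. bI n (Xd n \<omega>) (Yd n b \<omega>) j - b j))\<bar>}"]
              measure_le_SUP[OF PM[of n] b, where A = "\<lambda>b. {\<omega> \<in> space (M n). \<alpha> < \<bar>sqrt (qform (p n) (Sig n) (\<lambda>j. bII n (Xd n \<omega>) (Yd n b \<omega>) j - b j))\<bar>}"]
            by linarith
        qed
        with elim(1) a show ?case by linarith
      qed
    qed
  qed
  \<comment> \<open>q n is the variance of the leading term scaled by sqrt n, and
    \<open>Th n 0\<close> is the nominal variance in the claim; their ratio tends to 1.\<close>
  have r1: "((\<lambda>n. sqrt (q n / Th n 0)) \<longlongrightarrow> 1) evens"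
  proof -
    have "((\<lambda>n. d n * K) \<longlongrightarrow> 0 * K) evens" using elig2 unfolding d_def by (intro tendsto_intros)
    then have "((\<lambda>n. d n * K) \<longlongrightarrow> 0) evens" by simp
    then have "((\<lambda>n. q n / Th n 0 - 1) \<longlongrightarrow> 0) evens"
      by (rule Lim_null_comparison[rotated]) (use Th in \<open>eventually_elim, auto\<close>)
    then have "((\<lambda>n. q n / Th n 0) \<longlongrightarrow> 1) evens" by (simp add: LIM_zero_iff)
    from tendsto_real_sqrt[OF this] show ?thesis by simp
  qed
  obtain F where F: "\<And>z. (\<lambda>n. F n z) \<longlonglongrightarrow> Phi z"
    "\<And>n p a z. dotp p a a > 0 \<Longrightarrow> measure (sample_space n p)
      {\<omega> \<in> space (sample_space n p).
        (\<Sum>i<n. rowlin p a i \<omega> * \<omega> (i, p)) / sqrt (dotp p a a) / sqrt (real n) \<le> z} = F n z"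
    using rowlin_noise_clt by blast
  have Fe: "((\<lambda>n. F n z) \<longlongrightarrow> Phi z) evens" for z
    by (rule tendsto_mono[OF evens_le_sequentially F(1)])
  let ?G = "\<lambda>n b \<omega>. sqrt (real n) * (bhat n (p n) (R n) (Th n) (bI n) (bII n) b \<omega> - b 0) / sqrt (Th n 0)"
  have part2: "((\<lambda>n. SUP b\<in>B n. measure (M n) {\<omega> \<in> space (M n). ?G n b \<omega> \<le> z}) \<longlongrightarrow> Phi z) evens" for z
  proof (rule tendstoI)
    fix e :: real assume e: "0 < e"
    obtain t where t: "0 < t" "\<And>x. \<bar>x - z\<bar> < t \<Longrightarrow> \<bar>Phi x - Phi z\<bar> < e / 4"
      using isCont_Phi[of z] e unfolding continuous_at_eps_delta dist_real_def
      by (metis zero_less_divide_iff zero_less_numeral)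
    \<comment> \<open>A third of t, so that shifts by 2 \<delta> stay within the continuity radius
      t.\<close>
    define \<delta> where "\<delta> = t / 3"
    have \<delta>: "0 < \<delta>" "\<bar>Phi (z + 2 * \<delta>) - Phi z\<bar> < e / 4" "\<bar>Phi (z - 2 * \<delta>) - Phi z\<bar> < e / 4"
      using t(1) by (auto simp only: \<delta>_def intro!: t(2))
    let ?E = "\<lambda>n b. {\<omega> \<in> space (M n). \<delta> / 2 * (1 / sqrt (real n)) < \<bar>?err n b \<omega>\<bar>}"
    have "((\<lambda>n. SUP b\<in>B n. measure (M n) (?E n b)) \<longlongrightarrow> 0) evens"
      using part1 \<delta>(1) unfolding unif_oP_def by (auto dest!: spec[of _ "\<delta> / 2"])
    then have ev1: "eventually (\<lambda>n. (SUP b\<in>B n. measure (M n) (?E n b)) < e / 4) evens"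
      using e by (intro order_tendstoD(2)) auto
    \<comment> \<open>As the ratio of scalings tends to 1, the thresholds (z + \<delta>) / r and (z
      - \<delta>) / r eventually lie within the margin 2 \<delta> of z on the required
      sides.\<close>
    have lim: "((\<lambda>n. (z + \<delta>) / sqrt (q n / Th n 0)) \<longlongrightarrow> (z + \<delta>) / 1) evens"
      "((\<lambda>n. (z - \<delta>) / sqrt (q n / Th n 0)) \<longlongrightarrow> (z - \<delta>) / 1) evens"
      by (intro tendsto_intros r1; simp)+
    have ev2: "eventually (\<lambda>n. (z + \<delta>) / sqrt (q n / Th n 0) < z + 2 * \<delta>) evens"
        "eventually (\<lambda>n. z - 2 * \<delta> < (z - \<delta>) / sqrt (q n / Th n 0)) evens"
      using order_tendstoD(2)[OF lim(1), of "z + 2 * \<delta>"] order_tendstoD(1)[OF lim(2), of "z - 2 * \<delta>"] \<delta>(1)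
      by auto
    have ev3: "eventually (\<lambda>n. dist (F n (z + 2 * \<delta>)) (Phi (z + 2 * \<delta>)) < e / 4) evens"
      "eventually (\<lambda>n. dist (F n (z - 2 * \<delta>)) (Phi (z - 2 * \<delta>)) < e / 4) evens"
      using e by (intro tendstoD[OF Fe]; simp)+
    show "eventually (\<lambda>n. dist (SUP b\<in>B n. measure (M n) {\<omega> \<in> space (M n). ?G n b \<omega> \<le> z}) (Phi z) < e) evens"
      using Th eventually_evens ev1 ev2 ev3
    proof eventually_elim
      case (elim n)
      let ?S = "SUP b\<in>B n. measure (M n) {\<omega> \<in> space (M n). ?G n b \<omega> \<le> z}"
      have qd: "q n = dotp (p n) (mv (p n) (R n) (Th n)) (mv (p n) (R n) (Th n))"
        unfolding q_def qform_eq_dotp by (rule dotp_mv_gram[symmetric]) (rule root)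
      have q0: "0 < q n" using elim by auto
      \<comment> \<open>The law of the standardised leading term is given by F n alone, free of b,
        so the supremum over b affects only the remainder event \<open>?E\<close>.\<close>
      have W: "measure (M n) {\<omega> \<in> space (M n).
          (\<Sum>i<n. rowlin (p n) (mv (p n) (R n) (Th n)) i \<omega> * \<omega> (i, p n)) / sqrt (q n) / sqrt (real n) \<le> w} = F n w" for w
        unfolding M_def qd by (rule F(2)) (use q0 qd in simp)
      have bounds: "measure (M n) {\<omega> \<in> space (M n). ?G n b \<omega> \<le> z} \<le> F n (z + 2 * \<delta>) + measure (M n) (?E n b)"
        "F n (z - 2 * \<delta>) \<le> measure (M n) {\<omega> \<in> space (M n). ?G n b \<omega> \<le> z} + measure (M n) (?E n b)"
        if b: "b \<in> B n" for b
        unfolding W[symmetric] unfolding M_def Xd_def q_def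
        by (rule standardized_bhat_bounds[where S = "Sig n"];
            use elim b root p measI measII \<delta>(1) q0 in \<open>auto simp: M_def Xd_def Yd_def q_def\<close>)+
      have E: "measure (M n) (?E n b) < e / 4" if "b \<in> B n" for b
        using measure_le_SUP[OF PM[of n] that, of "?E n"] elim(3) by linarith
      have "?S \<le> F n (z + 2 * \<delta>) + e / 4"
      proof (rule cSUP_least)
        show "B n \<noteq> {}" using B_ne by blast
        fix b assume b: "b \<in> B n"
        show "measure (M n) {\<omega> \<in> space (M n). ?G n b \<omega> \<le> z} \<le> F n (z + 2 * \<delta>) + e / 4"
          using bounds(1)[OF b] E[OF b] by linarith
      qed
      moreover have "F n (z - 2 * \<delta>) \<le> ?S + e / 4"
      proof -
        obtain b where b: "b \<in> B n" using B_ne by blast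
        show ?thesis
          using bounds(2)[OF b] E[OF b]
            measure_le_SUP[OF PM[of n] b, of "\<lambda>b. {\<omega> \<in> space (M n). ?G n b \<omega> \<le> z}"] by linarith
      qed
      \<comment> \<open>Three errors below e / 4 are added on each side: the remainder, F n against
        Phi, and the shift of z in Phi.\<close>
      ultimately show ?case using elim \<delta> unfolding dist_real_def by linarith
    qed
  qed
  show ?thesis using part1 part2 by blast
qed

end
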